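(* Let $H,H'$ be Hilbert spaces, let $\pi$ be a C$^*$-algebra homomorphism from a C$^*$-algebra $A\subseteq\mathcal{B}(H)$ to a C$^*$-algebra $B\subseteq\mathcal{B}(H')$, take $P_0,\ldots,P_n\in\mathcal{P}(A)$ and set $T=P_0\cdots P_n$, $P=P_0\wedge\ldots\wedge P_n$ and $p=\pi(P_0)\wedge\ldots\wedge\pi(P_n)$. (i) If $\sup(\sigma(T^*T)\setminus\{1\})<1$ then $P\in A$ and $\pi(P)=p$. (ii) Further assume that $A$ has real rank zero, $\mathcal{P}(B)$ is $\sigma$-closed and $\pi^{-1}[\{0\}]\subseteq\mathcal{K}(H)$. If there is some $R\in\mathcal{P}(A)$ with $R\leq P_k$ for all $k\leq n$ such that $\pi(R)$ is a greatest lower bound of $\pi(P_0),\ldots,\pi(P_n)$ in $\mathcal{P}(B)$, then $\sup(\sigma(T^*T)\setminus\{1\})<1$.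
   Context: Hilbert spaces and C$^*$-algebras are over $\mathbb{F}=\mathbb{R}$ or $\mathbb{C}$. $\mathcal{P}(A)$ is the set of projections (self-adjoint idempotents) of $A$, ordered by $P\leq Q\Leftrightarrow PQ=P$. $P_0\wedge\ldots\wedge P_n$ denotes the greatest lower bound in $\mathcal{P}(\mathcal{B}(H))$, i.e. the projection onto $\bigcap_k\mathcal{R}(P_k)$ (where $\mathcal{R}$ denotes range); likewise $\pi(P_0)\wedge\ldots\wedge\pi(P_n)$ is the greatest lower bound in $\mathcal{P}(\mathcal{B}(H'))$. $\sigma(S)$ is the spectrum of $S$ as an element of $\mathcal{B}(H)$, and $\sup\emptyset<1$ by convention. $\mathcal{K}(H)$ is the set of compact operators on $H$. Homomorphisms preserve addition, (scalar) multiplication and adjoints and, if the identity operator of $H$ lies in $A$, send it to the identity operator of $H'$. $A$ has real rank zero if the invertible self-adjoint elements are dense in the self-adjoint elements of $A$ (of $A$ with a unit adjoined, if $A$ has none). A partially ordered set with minimum $0$ is $\sigma$-closed if every decreasing sequence of non-zero elements has a non-zero lower bound in it. *)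

theory Defs
  imports "HOL-Analysis.Analysis"
begin

section \<open>The scalar field\<close>

text \<open>
  A type of this class is a copy of the real or of the complex numbers: the axioms make
  \<open>to_complex\<close> an injective homomorphism of real algebras onto \<open>\<real>\<close> or onto all of \<open>complex\<close>.
\<close>

class real_or_complex_field = real_field +
  fixes to_complex :: "'a \<Rightarrow> complex"
  assumes to_complex_add: "to_complex (x + y) = to_complex x + to_complex y"
    and to_complex_mult: "to_complex (x * y) = to_complex x * to_complex y"
    and to_complex_scaleR: "to_complex (r *\<^sub>R x) = r *\<^sub>R to_complex x"
    and to_complex_one: "to_complex 1 = 1"
    and range_to_complex: "range to_complex = \<real> \<or> range to_complex = UNIV"

instantiation real :: real_or_complex_field
begin
definition to_complex_real :: "real \<Rightarrow> complex" where "to_complex_real = complex_of_real"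
instance
  by standard (auto simp: to_complex_real_def Reals_def scaleR_conv_of_real)
end

instantiation complex :: real_or_complex_field
begin
definition to_complex_complex :: "complex \<Rightarrow> complex" where "to_complex_complex = (\<lambda>z. z)"
instance
  by standard (auto simp: to_complex_complex_def)
end


section \<open>Hilbert spaces over the scalar field\<close>

text \<open>
  The type \<open>'h\<close> carries the norm, its completeness and the underlying real vector space structure;
  \<open>smul\<close> and \<open>ip\<close> are the scalar multiplication and the inner product over \<open>'f\<close>. Every Hilbert
  space over \<open>'f\<close> arises in this way, its real inner product being the real part of \<open>ip\<close>.
\<close>

locale hilbert_space_over = vector_space smul
  for smul :: "'f::real_or_complex_field \<Rightarrow> 'h::{real_inner,complete_space} \<Rightarrow> 'h" +
  fixes ip :: "'h \<Rightarrow> 'h \<Rightarrow> 'f"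
  assumes smul_of_real: "smul (of_real r) x = r *\<^sub>R x"
    and ip_add_left: "ip (x + y) z = ip x z + ip y z"
    and ip_smul_left: "ip (smul c x) y = c * ip x y"
    and ip_commute: "to_complex (ip y x) = cnj (to_complex (ip x y))"
    and ip_self: "ip x x = of_real ((norm x)\<^sup>2)"


section \<open>Bounded operators\<close>

text \<open>
  Elements of the type \<open>'h \<Rightarrow>\<^sub>L 'h\<close> are bounded and real-linear. It carries the operator norm, and
  \<open>closed\<close> and \<open>closure\<close> refer to the norm topology.
\<close>

definition bounded_ops ::
    "('f::real_or_complex_field \<Rightarrow> 'h \<Rightarrow> 'h) \<Rightarrow> ('h::{real_inner,complete_space} \<Rightarrow>\<^sub>L 'h) set" where
  "bounded_ops smul = {T. \<forall>c x. blinfun_apply T (smul c x) = smul c (blinfun_apply T x)}"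

definition smul_op ::
    "('f::real_or_complex_field \<Rightarrow> 'h \<Rightarrow> 'h) \<Rightarrow> 'f \<Rightarrow> ('h::{real_inner,complete_space} \<Rightarrow>\<^sub>L 'h) \<Rightarrow> ('h \<Rightarrow>\<^sub>L 'h)" where
  "smul_op smul c T = Blinfun (\<lambda>x. smul c (blinfun_apply T x))"

definition adj ::
    "('h \<Rightarrow> 'h \<Rightarrow> 'f::real_or_complex_field) \<Rightarrow> ('h::{real_inner,complete_space} \<Rightarrow>\<^sub>L 'h) \<Rightarrow> ('h \<Rightarrow>\<^sub>L 'h)" where
  "adj ip T = (THE S. \<forall>x y. ip (blinfun_apply T x) y = ip x (blinfun_apply S y))"

definition compact_ops ::
    "('f::real_or_complex_field \<Rightarrow> 'h \<Rightarrow> 'h) \<Rightarrow> ('h::{real_inner,complete_space} \<Rightarrow>\<^sub>L 'h) set" where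
  "compact_ops smul = {T \<in> bounded_ops smul. compact (closure (blinfun_apply T ` cball 0 1))}"

definition op_spectrum ::
    "('f::real_or_complex_field \<Rightarrow> 'h \<Rightarrow> 'h) \<Rightarrow> ('h::{real_inner,complete_space} \<Rightarrow>\<^sub>L 'h) \<Rightarrow> 'f set" where
  "op_spectrum smul S =
     {c. \<not> (\<exists>R \<in> bounded_ops smul.
            (S - smul_op smul c id_blinfun) o\<^sub>L R = id_blinfun \<and>
            R o\<^sub>L (S - smul_op smul c id_blinfun) = id_blinfun)}"

primrec op_prod :: "(nat \<Rightarrow> ('h::real_normed_vector \<Rightarrow>\<^sub>L 'h)) \<Rightarrow> nat \<Rightarrow> ('h \<Rightarrow>\<^sub>L 'h)" where
  "op_prod P 0 = P 0"
| "op_prod P (Suc k) = op_prod P k o\<^sub>L P (Suc k)"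


section \<open>Order-theoretic notions\<close>

definition is_glb :: "('a \<Rightarrow> 'a \<Rightarrow> bool) \<Rightarrow> 'a set \<Rightarrow> 'a set \<Rightarrow> 'a \<Rightarrow> bool" where
  "is_glb le S L g \<longleftrightarrow>
     g \<in> S \<and> (\<forall>x\<in>L. le g x) \<and> (\<forall>h\<in>S. (\<forall>x\<in>L. le h x) \<longrightarrow> le h g)"

text \<open>Here \<open>z\<close> is the minimum of the set \<open>S\<close> ordered by \<open>le\<close>.\<close>

definition sigma_closed :: "('a \<Rightarrow> 'a \<Rightarrow> bool) \<Rightarrow> 'a \<Rightarrow> 'a set \<Rightarrow> bool" where
  "sigma_closed le z S \<longleftrightarrow>
     (\<forall>q :: nat \<Rightarrow> 'a. (\<forall>n. q n \<in> S \<and> q n \<noteq> z \<and> le (q (Suc n)) (q n)) \<longrightarrow>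
        (\<exists>r\<in>S. r \<noteq> z \<and> (\<forall>n. le r (q n))))"


section \<open>Concrete C*-algebras\<close>

text \<open>A C*-algebra of operators need not contain the identity operator.\<close>

definition cstar_algebra_on ::
    "('f::real_or_complex_field \<Rightarrow> 'h \<Rightarrow> 'h) \<Rightarrow> ('h \<Rightarrow> 'h \<Rightarrow> 'f) \<Rightarrow> ('h::{real_inner,complete_space} \<Rightarrow>\<^sub>L 'h) set \<Rightarrow> bool" where
  "cstar_algebra_on smul ip A \<longleftrightarrow>
     A \<subseteq> bounded_ops smul \<and> 0 \<in> A \<and>
     (\<forall>a\<in>A. \<forall>b\<in>A. a + b \<in> A) \<and>
     (\<forall>c. \<forall>a\<in>A. smul_op smul c a \<in> A) \<and>
     (\<forall>a\<in>A. \<forall>b\<in>A. a o\<^sub>L b \<in> A) \<and>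
     (\<forall>a\<in>A. adj ip a \<in> A) \<and>
     closed A"

definition cstar_hom ::
    "('f::real_or_complex_field \<Rightarrow> 'h \<Rightarrow> 'h) \<Rightarrow> ('h \<Rightarrow> 'h \<Rightarrow> 'f) \<Rightarrow> ('h::{real_inner,complete_space} \<Rightarrow>\<^sub>L 'h) set \<Rightarrow>
     ('f \<Rightarrow> 'k \<Rightarrow> 'k) \<Rightarrow> ('k \<Rightarrow> 'k \<Rightarrow> 'f) \<Rightarrow> ('k::{real_inner,complete_space} \<Rightarrow>\<^sub>L 'k) set \<Rightarrow>
     (('h \<Rightarrow>\<^sub>L 'h) \<Rightarrow> ('k \<Rightarrow>\<^sub>L 'k)) \<Rightarrow> bool" where
  "cstar_hom smul ip A smul' ip' B \<pi> \<longleftrightarrow>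
     \<pi> ` A \<subseteq> B \<and>
     (\<forall>a\<in>A. \<forall>b\<in>A. \<pi> (a + b) = \<pi> a + \<pi> b) \<and>
     (\<forall>c. \<forall>a\<in>A. \<pi> (smul_op smul c a) = smul_op smul' c (\<pi> a)) \<and>
     (\<forall>a\<in>A. \<forall>b\<in>A. \<pi> (a o\<^sub>L b) = \<pi> a o\<^sub>L \<pi> b) \<and>
     (\<forall>a\<in>A. \<pi> (adj ip a) = adj ip' (\<pi> a)) \<and>
     (id_blinfun \<in> A \<longrightarrow> \<pi> id_blinfun = id_blinfun)"

definition projections ::
    "('h \<Rightarrow> 'h \<Rightarrow> 'f::real_or_complex_field) \<Rightarrow> ('h::{real_inner,complete_space} \<Rightarrow>\<^sub>L 'h) set \<Rightarrow> ('h \<Rightarrow>\<^sub>L 'h) set" where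
  "projections ip A = {P \<in> A. adj ip P = P \<and> P o\<^sub>L P = P}"

definition proj_le :: "('h::real_normed_vector \<Rightarrow>\<^sub>L 'h) \<Rightarrow> ('h \<Rightarrow>\<^sub>L 'h) \<Rightarrow> bool" where
  "proj_le P Q \<longleftrightarrow> P o\<^sub>L Q = P"

definition proj_meet ::
    "('f::real_or_complex_field \<Rightarrow> 'h \<Rightarrow> 'h) \<Rightarrow> ('h \<Rightarrow> 'h \<Rightarrow> 'f) \<Rightarrow> ('h::{real_inner,complete_space} \<Rightarrow>\<^sub>L 'h) set \<Rightarrow> ('h \<Rightarrow>\<^sub>L 'h)" where
  "proj_meet smul ip L = (THE g. is_glb proj_le (projections ip (bounded_ops smul)) L g)"

definition is_unit_of :: "('h::real_normed_vector \<Rightarrow>\<^sub>L 'h) set \<Rightarrow> ('h \<Rightarrow>\<^sub>L 'h) \<Rightarrow> bool" where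
  "is_unit_of A e \<longleftrightarrow> e \<in> A \<and> (\<forall>a\<in>A. e o\<^sub>L a = a \<and> a o\<^sub>L e = a)"

text \<open>
  A unit of \<open>A\<close> may differ from the identity operator. If \<open>A\<close> has no unit at all, then the
  identity operator is not in \<open>A\<close>, so that adding its multiples realises the abstract unitization.
\<close>

definition unitization ::
    "('f::real_or_complex_field \<Rightarrow> 'h \<Rightarrow> 'h) \<Rightarrow> ('h::{real_inner,complete_space} \<Rightarrow>\<^sub>L 'h) set \<Rightarrow> ('h \<Rightarrow>\<^sub>L 'h) set" where
  "unitization smul A =
     (if \<exists>e. is_unit_of A e then A
      else {a + smul_op smul c id_blinfun |a c. a \<in> A})"

definition real_rank_zero ::
    "('f::real_or_complex_field \<Rightarrow> 'h \<Rightarrow> 'h) \<Rightarrow> ('h \<Rightarrow> 'h \<Rightarrow> 'f) \<Rightarrow> ('h::{real_inner,complete_space} \<Rightarrow>\<^sub>L 'h) set \<Rightarrow> bool" where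
  "real_rank_zero smul ip A \<longleftrightarrow>
     (\<exists>e. is_unit_of (unitization smul A) e \<and>
        {a \<in> unitization smul A. adj ip a = a} \<subseteq>
        closure {a \<in> unitization smul A. adj ip a = a \<and>
                   (\<exists>b \<in> unitization smul A. a o\<^sub>L b = e \<and> b o\<^sub>L a = e)})"

text \<open>
  The condition that \<open>sup (\<sigma>(S) - {1}) < 1\<close>, for a self-adjoint \<open>S\<close>, whose spectrum is real. The supremum is
  taken in the extended reals, where \<open>Sup {} = -\<infinity> < 1\<close>.
\<close>

definition spectral_gap_at_one ::
    "('f::real_or_complex_field \<Rightarrow> 'h \<Rightarrow> 'h) \<Rightarrow> ('h::{real_inner,complete_space} \<Rightarrow>\<^sub>L 'h) \<Rightarrow> bool" where
  "spectral_gap_at_one smul S \<longleftrightarrow>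
     (SUP c \<in> op_spectrum smul S - {1}. ereal (Re (to_complex c))) < 1"

end

theory Submission
  imports Defs
begin

text \<open>
  Let \<open>M\<close> be the intersection of the ranges of the \<open>P k\<close>, \<open>g\<close> the projection onto \<open>M\<close> and
  \<open>S = T\<^sup>* T\<close>, so that \<open>M\<close> is the fixed space of \<open>S\<close>. The spectral gap of \<open>S\<close> at \<open>1\<close> is equivalent to
  \<open>\<parallel>T u\<parallel>\<^sup>2 \<le> r \<parallel>u\<parallel>\<^sup>2\<close> for all \<open>u \<bottom> M\<close> and some \<open>r < 1\<close>.

  (i) The gap gives \<open>\<parallel>S - g\<parallel> < 1\<close>, so the powers of \<open>S\<close> converge to \<open>g\<close> in norm and \<open>g \<in> A\<close>. The Neumann
  series provides a quasi-inverse of \<open>S - g\<close> in \<open>A\<close>; its image shows that \<open>\<pi> (S - g)\<close> does not have the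
  eigenvalue \<open>1\<close>, hence \<open>\<pi> S\<close> has no fixed points outside the range of \<open>\<pi> g\<close>.

  (ii) Without a gap there are unit vectors \<open>y\<^sub>k \<bottom> M\<close> with \<open>S y\<^sub>k - y\<^sub>k \<rightarrow> 0\<close>. Put \<open>d = e - (S - R)\<close>, where
  \<open>e\<close> is the unit. Starting from \<open>E\<^sub>0 = e\<close>, real rank zero yields a projection \<open>Q = c z c\<close> with
  \<open>c = E\<^sub>n d E\<^sub>n\<close> such that \<open>\<parallel>c - Q c\<parallel>\<close> is small, and \<open>E\<^sub>n\<^sub>+\<^sub>1 = E\<^sub>n - Q\<close>. As \<open>d y\<^sub>k \<rightarrow> 0\<close>, all
  \<open>E\<^sub>n\<close> asymptotically fix the \<open>y\<^sub>k\<close>, so they are not compact and \<open>\<pi> E\<^sub>n \<noteq> 0\<close>; moreover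
  \<open>\<parallel>E\<^sub>n d E\<^sub>n\<parallel> \<rightarrow> 0\<close>. A projection below all \<open>\<pi> E\<^sub>n\<close> is therefore below all \<open>\<pi> (P k)\<close> and orthogonal
  to \<open>\<pi> R\<close>, so it vanishes, contradicting that the projections of \<open>B\<close> are \<open>\<sigma>\<close>-closed.
\<close>

section \<open>Real Hilbert spaces\<close>

lemma hilbert_projection:
  fixes M :: "'h::{real_inner,complete_space} set"
  assumes M: "subspace M" and cl: "closed M"
  obtains p where "p \<in> M" "\<And>m. m \<in> M \<Longrightarrow> inner (x - p) m = 0"
proof -
  define d where "d = infdist x M"
  have ne: "M \<noteq> {}" using subspace_0[OF M] by auto
  have d0: "0 \<le> d" by (simp add: d_def infdist_nonneg)
  have dle: "d\<^sup>2 \<le> (norm (x - m))\<^sup>2" if "m \<in> M" for m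
    using infdist_le[OF that, of x] d0 by (simp add: d_def dist_norm power_mono)
  have "\<exists>m\<in>M. (norm (x - m))\<^sup>2 < d\<^sup>2 + 1 / (real k + 1)" for k
  proof -
    have "d < sqrt (d\<^sup>2 + 1 / (real k + 1))"
      by (rule real_less_rsqrt) simp
    then have "\<exists>m\<in>M. dist x m < sqrt (d\<^sup>2 + 1 / (real k + 1))"
      using cInf_lessD[of "dist x ` M"] ne by (auto simp: d_def infdist_notempty)
    then obtain m where m: "m \<in> M" "norm (x - m) < sqrt (d\<^sup>2 + 1 / (real k + 1))"
      by (auto simp: dist_norm)
    have "0 \<le> d\<^sup>2 + 1 / (real k + 1)" by simp
    with power_strict_mono[OF m(2), of 2] show ?thesis using m(1) by (intro bexI[of _ m]) auto
  qed
  then obtain m where m: "\<And>k. m k \<in> M" "\<And>k. (norm (x - m k))\<^sup>2 < d\<^sup>2 + 1 / (real k + 1)"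
    by metis
  have close: "(norm (m i - m j))\<^sup>2 \<le> 2 / (real i + 1) + 2 / (real j + 1)" for i j
  proof -
    have "(1/2) *\<^sub>R (m i + m j) \<in> M"
      using m(1) M by (intro subspace_scale subspace_add)
    then have "d\<^sup>2 \<le> (norm (x - (1/2) *\<^sub>R (m i + m j)))\<^sup>2" by (rule dle)
    moreover have "(norm (m i - m j))\<^sup>2 = 2 * (norm (x - m i))\<^sup>2 + 2 * (norm (x - m j))\<^sup>2
        - 4 * (norm (x - (1/2) *\<^sub>R (m i + m j)))\<^sup>2"
      by (simp add: power2_norm_eq_inner inner_diff inner_add algebra_simps inner_commute)
    ultimately show ?thesis using m(2)[of i] m(2)[of j] by simp
  qed
  have "Cauchy m"
  proof (rule metric_CauchyI)
    fix e :: real assume e: "0 < e"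
    obtain N :: nat where N: "4 / e\<^sup>2 < real N" using reals_Archimedean2 by blast
    have "dist (m i) (m j) < e" if "i \<ge> N" "j \<ge> N" for i j
    proof -
      have "2 / (real k + 1) < e\<^sup>2 / 2" if "k \<ge> N" for k
      proof -
        have "4 / e\<^sup>2 < real k + 1" using N that by linarith
        then have "4 < (real k + 1) * e\<^sup>2" using e by (simp add: pos_divide_less_eq)
        then show ?thesis by (simp add: pos_divide_less_eq algebra_simps)
      qed
      from this[of i] this[of j] that have "(norm (m i - m j))\<^sup>2 < e\<^sup>2"
        using close[of i j] by linarith
      then show ?thesis using e by (simp add: dist_norm power2_less_imp_less)
    qed
    then show "\<exists>N. \<forall>i\<ge>N. \<forall>j\<ge>N. dist (m i) (m j) < e" by blast
  qed
  then obtain p where p: "m \<longlonglongrightarrow> p" using Cauchy_convergent convergent_def by blast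
  have pM: "p \<in> M" using closed_sequentially[OF cl _ p] m(1) by blast
  have "(\<lambda>k. (norm (x - m k))\<^sup>2) \<longlonglongrightarrow> (norm (x - p))\<^sup>2" by (intro tendsto_intros p)
  moreover have "(\<lambda>k. d\<^sup>2 + 1 / (real k + 1)) \<longlonglongrightarrow> d\<^sup>2"
    using tendsto_add[OF tendsto_const[of "d\<^sup>2"] LIMSEQ_inverse_real_of_nat]
    by (simp add: inverse_eq_divide add.commute)
  ultimately have pd: "(norm (x - p))\<^sup>2 \<le> d\<^sup>2"
    using m(2) by (intro LIMSEQ_le) (auto intro: less_imp_le)
  have "inner (x - p) u = 0" if u: "u \<in> M" for u
  proof (cases "u = 0")
    case False
    define t where "t = inner (x - p) u / inner u u"
    have "p + t *\<^sub>R u \<in> M" using M pM u by (intro subspace_add subspace_scale)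
    then have "(norm (x - p))\<^sup>2 \<le> (norm ((x - p) - t *\<^sub>R u))\<^sup>2"
      using dle pd by (metis diff_diff_eq order_trans)
    also have "\<dots> = (norm (x - p))\<^sup>2 - 2 * t * inner (x - p) u + t * t * inner u u"
      unfolding power2_norm_eq_inner
      by (simp add: inner_diff_left inner_diff_right inner_commute algebra_simps)
    also have "\<dots> = (norm (x - p))\<^sup>2 - (inner (x - p) u)\<^sup>2 / inner u u"
      using False by (simp add: t_def field_simps power2_eq_square)
    finally have "(inner (x - p) u)\<^sup>2 / inner u u \<le> 0" by simp
    moreover have "inner u u > 0" using False by simp
    ultimately show ?thesis by (simp add: divide_le_0_iff)
  qed simp
  with pM that show ?thesis by blast
qed

lemma riesz_representation:
  fixes f :: "'h::{real_inner,complete_space} \<Rightarrow> real"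
  assumes f: "bounded_linear f"
  obtains u where "\<And>x. f x = inner x u"
proof (cases "\<forall>x. f x = 0")
  case True
  then show ?thesis using that[of 0] by simp
next
  case False
  interpret bounded_linear f by fact
  obtain w where w: "f w \<noteq> 0" using False by blast
  define N where "N = {x. f x = 0}"
  have "subspace N" by (auto simp: N_def subspace_def add zero scaleR)
  moreover have "closed N"
    unfolding N_def by (intro closed_Collect_eq continuous_intros continuous_on)
  ultimately obtain p where p: "p \<in> N" "\<And>m. m \<in> N \<Longrightarrow> inner (w - p) m = 0"
    using hilbert_projection by metis
  define v where "v = w - p"
  have fv: "f v = f w" using p(1) by (simp add: v_def diff N_def)
  then have v: "inner v v \<noteq> 0" using w zero by auto
  have "f x = inner x ((f v / inner v v) *\<^sub>R v)" for x
  proof -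
    have "x - (f x / f v) *\<^sub>R v \<in> N" using w by (simp add: N_def diff scaleR fv)
    then have "inner v (x - (f x / f v) *\<^sub>R v) = 0" using p(2) by (simp add: v_def)
    then show ?thesis using v w fv
      by (simp add: inner_diff_right field_simps inner_commute)
  qed
  then show ?thesis using that by blast
qed

lemma hilbert_adjoint_exists:
  fixes T :: "'h::{real_inner,complete_space} \<Rightarrow>\<^sub>L 'h"
  obtains U :: "'h \<Rightarrow>\<^sub>L 'h" where "\<And>x y. inner (T x) y = inner x (U y)"
proof -
  have "\<exists>u. \<forall>x. inner (T x) y = inner x u" for y
    by (rule riesz_representation[of "\<lambda>x. inner (T x) y"])
      (auto intro!: bounded_linear_intros)
  then obtain U where U: "\<And>x y. inner (T x) y = inner x (U y)" by metis
  have eq: "u = v" if "\<And>x. inner x u = inner x v" for u v :: 'h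
  proof -
    have "inner (u - v) (u - v) = 0" using that by (simp add: inner_diff_right)
    then show ?thesis by simp
  qed
  have "bounded_linear U"
  proof (rule bounded_linear_intro)
    show "U (x + y) = U x + U y" for x y
      by (rule eq) (metis U inner_add_right)
    show "U (r *\<^sub>R x) = r *\<^sub>R U x" for r x
      by (rule eq) (metis U inner_scaleR_right)
    show "norm (U y) \<le> norm y * norm T" for y
    proof (cases "norm (U y) = 0")
      case False
      have "(norm (U y))\<^sup>2 = inner (T (U y)) y" by (simp add: U power2_norm_eq_inner)
      also have "\<dots> \<le> norm (T (U y)) * norm y" by (rule norm_cauchy_schwarz)
      also have "\<dots> \<le> (norm T * norm (U y)) * norm y"
        by (intro mult_right_mono norm_blinfun) auto
      finally show ?thesis using False by (simp add: power2_eq_square algebra_simps)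
    qed simp
  qed
  then show ?thesis using that[of "Blinfun U"] U by (simp add: bounded_linear_Blinfun_apply)
qed

lemma blinfun_Cauchy_convergent:
  fixes X :: "nat \<Rightarrow> ('a::real_normed_vector \<Rightarrow>\<^sub>L 'b::{real_normed_vector,complete_space})"
  assumes X: "Cauchy X"
  obtains L where "X \<longlonglongrightarrow> L"
proof -
  have pw: "norm (X m x - X n x) \<le> norm (X m - X n) * norm x" for m n x
    by (metis blinfun.diff_left norm_blinfun)
  have "Cauchy (\<lambda>n. X n x)" for x
  proof (rule metric_CauchyI)
    fix e :: real assume "0 < e"
    then have "0 < e / (norm x + 1)" by (simp add: add_nonneg_pos)
    with metric_CauchyD[OF X] obtain N
      where N: "\<And>m n. m \<ge> N \<Longrightarrow> n \<ge> N \<Longrightarrow> dist (X m) (X n) < e / (norm x + 1)" by blast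
    have "dist (X m x) (X n x) < e" if "m \<ge> N" "n \<ge> N" for m n
    proof -
      have "norm (X m - X n) * norm x \<le> e / (norm x + 1) * norm x"
        using N[OF that] by (intro mult_right_mono) (auto simp: dist_norm)
      also have "\<dots> < e"
      proof -
        have "0 < norm x + 1" by (simp add: add_nonneg_pos)
        then show ?thesis using \<open>0 < e\<close> by (simp add: pos_divide_less_eq distrib_left)
      qed
      finally show ?thesis using pw[of m x n] by (simp add: dist_norm)
    qed
    then show "\<exists>N. \<forall>m\<ge>N. \<forall>n\<ge>N. dist (X m x) (X n x) < e" by blast
  qed
  then have "\<exists>l. (\<lambda>n. X n x) \<longlonglongrightarrow> l" for x
    using Cauchy_convergent convergent_def by blast
  then obtain f where f: "\<And>x. (\<lambda>n. X n x) \<longlonglongrightarrow> f x" by metis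
  obtain C where C: "\<And>n. norm (X n) \<le> C"
    using Cauchy_Bseq[OF X] by (auto simp: Bseq_def)
  have "bounded_linear f"
  proof (rule bounded_linear_intro)
    show "f (x + y) = f x + f y" for x y
      by (rule LIMSEQ_unique[OF f]) (simp add: blinfun.add_right tendsto_add f)
    show "f (r *\<^sub>R x) = r *\<^sub>R f x" for r x
      by (rule LIMSEQ_unique[OF f]) (simp add: blinfun.scaleR_right tendsto_scaleR f)
    show "norm (f x) \<le> norm x * C" for x
    proof (rule LIMSEQ_le_const2[OF tendsto_norm[OF f]], intro exI allI impI)
      fix n show "norm (X n x) \<le> norm x * C"
        using norm_blinfun[of "X n" x] mult_right_mono[OF C norm_ge_zero[of x]]
        by (simp add: mult.commute order_trans)
    qed
  qed
  then have ap: "blinfun_apply (Blinfun f) = f" by (rule bounded_linear_Blinfun_apply)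
  have "X \<longlonglongrightarrow> Blinfun f"
  proof (rule metric_LIMSEQ_I)
    fix e :: real assume e: "0 < e"
    with metric_CauchyD[OF X, of "e/2"] obtain N
      where N: "\<And>m n. m \<ge> N \<Longrightarrow> n \<ge> N \<Longrightarrow> dist (X m) (X n) < e/2" by auto
    have *: "norm (X n - Blinfun f) \<le> e/2" if n: "n \<ge> N" for n
    proof (rule norm_blinfun_bound)
      fix x
      have "(\<lambda>m. norm (X n x - X m x)) \<longlonglongrightarrow> norm (X n x - f x)"
        by (intro tendsto_intros f)
      then show "norm ((X n - Blinfun f) x) \<le> e/2 * norm x"
        unfolding blinfun.diff_left ap
      proof (rule LIMSEQ_le_const2, intro exI[of _ N] allI impI)
        fix m assume "N \<le> m"
        then have "norm (X n - X m) \<le> e/2" using N n by (metis dist_norm less_imp_le)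
        then show "norm (X n x - X m x) \<le> e/2 * norm x"
          using pw[of n x m] by (smt (verit) mult_right_mono norm_ge_zero)
      qed
    qed (use e in simp)
    then show "\<exists>N. \<forall>n\<ge>N. dist (X n) (Blinfun f) < e"
    proof (intro exI[of _ N] allI impI)
      fix n assume "N \<le> n"
      with *[of n] e show "dist (X n) (Blinfun f) < e" by (simp add: dist_norm)
    qed
  qed
  then show ?thesis using that by blast
qed

lemma blinfun_geometric_limit:
  fixes X :: "nat \<Rightarrow> ('a::real_normed_vector \<Rightarrow>\<^sub>L 'b::{real_normed_vector,complete_space})"
  assumes step: "\<And>k. norm (X (Suc k) - X k) \<le> C * t ^ k" and t: "0 \<le> t" "t < 1"
  obtains L where "X \<longlonglongrightarrow> L"
proof -
  define u where "u n = (\<Sum>k<n. C * t ^ k)" for n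
  have le: "norm (X (m + j) - X m) \<le> u (m + j) - u m" for m j
  proof (induction j)
    case (Suc j)
    have "norm (X (m + Suc j) - X m) \<le> norm (X (m + Suc j) - X (m + j)) + norm (X (m + j) - X m)"
      by (metis diff_add_cancel add_diff_eq norm_triangle_ineq)
    with Suc step[of "m + j"] show ?case by (simp add: u_def)
  qed simp
  have "summable (\<lambda>k. C * t ^ k)" using t by (intro summable_mult summable_geometric) auto
  then have "convergent u"
    unfolding summable_iff_convergent u_def [abs_def] .
  then have "Cauchy u" by (rule convergent_Cauchy)
  have "Cauchy X"
  proof (rule CauchyI')
    fix e :: real assume "0 < e"
    with \<open>Cauchy u\<close> obtain N where N: "\<And>m n. m \<ge> N \<Longrightarrow> n \<ge> N \<Longrightarrow> norm (u m - u n) < e"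
      by (meson CauchyD)
    have "dist (X m) (X n) < e" if "m \<ge> N" "n > m" for m n
      using le[of m "n - m"] N[of n m] that by (simp add: dist_norm norm_minus_commute)
    then show "\<exists>M. \<forall>m\<ge>M. \<forall>n>m. dist (X m) (X n) < e" by blast
  qed
  then show ?thesis using blinfun_Cauchy_convergent that by blast
qed

section \<open>Symmetric operators and operator algebras\<close>

definition symmetric_op :: "('h::real_inner \<Rightarrow>\<^sub>L 'h) \<Rightarrow> bool" where
  "symmetric_op S \<longleftrightarrow> (\<forall>x y. inner (S x) y = inner x (S y))"

lemma symmetric_opD: "symmetric_op S \<Longrightarrow> inner (S x) y = inner x (S y)"
  by (simp add: symmetric_op_def)

lemma symmetric_op_simps [intro]:
  "symmetric_op 0" "symmetric_op id_blinfun"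
  "symmetric_op S \<Longrightarrow> symmetric_op U \<Longrightarrow> symmetric_op (S + U)"
  "symmetric_op S \<Longrightarrow> symmetric_op U \<Longrightarrow> symmetric_op (S - U)"
  "symmetric_op S \<Longrightarrow> symmetric_op (r *\<^sub>R S)"
  by (auto simp: symmetric_op_def blinfun.bilinear_simps inner_add inner_diff)

lemma symmetric_op_compose:
  "symmetric_op S \<Longrightarrow> symmetric_op U \<Longrightarrow> S o\<^sub>L U = U o\<^sub>L S \<Longrightarrow> symmetric_op (S o\<^sub>L U)"
  unfolding symmetric_op_def by (metis blinfun_apply_blinfun_compose)

lemma symmetric_op_conj:
  "symmetric_op S \<Longrightarrow> symmetric_op U \<Longrightarrow> symmetric_op (S o\<^sub>L U o\<^sub>L S)"
  by (simp add: symmetric_op_def)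

lemma symmetric_op_unique:
  fixes S U :: "'h::real_inner \<Rightarrow>\<^sub>L 'h"
  assumes "\<And>x y. inner (S x) y = inner (U x) y"
  shows "S = U"
proof (rule blinfun_eqI)
  fix x
  have "inner (S x - U x) (S x - U x) = 0" using assms by (simp add: inner_diff_left)
  then show "S x = U x" by simp
qed

lemma symmetric_op_limit:
  assumes "\<And>k. symmetric_op (X k)" "X \<longlonglongrightarrow> L"
  shows "symmetric_op L"
  unfolding symmetric_op_def
proof (intro allI)
  fix x y
  have "(\<lambda>k. inner (X k x) y) \<longlonglongrightarrow> inner (L x) y" "(\<lambda>k. inner x (X k y)) \<longlonglongrightarrow> inner x (L y)"
    by (intro tendsto_intros assms)+
  moreover have "(\<lambda>k. inner (X k x) y) = (\<lambda>k. inner x (X k y))"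
    using assms(1) by (simp add: symmetric_op_def)
  ultimately show "inner (L x) y = inner x (L y)" using LIMSEQ_unique by metis
qed

lemma form_cauchy_schwarz:
  assumes C: "symmetric_op C" and pos: "\<And>x. 0 \<le> inner (C x) x"
  shows "(inner (C x) y)\<^sup>2 \<le> inner (C x) x * inner (C y) y"
proof -
  define \<alpha> \<beta> \<gamma> where "\<alpha> = inner (C x) x" and "\<beta> = inner (C x) y" and "\<gamma> = inner (C y) y"
  have q: "0 \<le> \<alpha> + 2 * t * \<beta> + t\<^sup>2 * \<gamma>" for t
  proof -
    have "inner (C y) x = \<beta>" using C by (simp add: \<beta>_def symmetric_op_def inner_commute)
    then have "inner (C (x + t *\<^sub>R y)) (x + t *\<^sub>R y) = \<alpha> + 2 * t * \<beta> + t\<^sup>2 * \<gamma>"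
      by (simp add: blinfun.bilinear_simps inner_add \<alpha>_def \<beta>_def \<gamma>_def power2_eq_square algebra_simps)
    then show ?thesis using pos[of "x + t *\<^sub>R y"] by simp
  qed
  have "0 \<le> \<gamma>" using pos by (simp add: \<gamma>_def)
  show ?thesis
  proof (cases "\<gamma> = 0")
    case True
    have "\<beta> = 0"
    proof (rule ccontr)
      assume "\<beta> \<noteq> 0"
      then have "2 * (- (\<alpha> + 1) / (2 * \<beta>)) * \<beta> = - (\<alpha> + 1)" by simp
      then show False using q[of "- (\<alpha> + 1) / (2 * \<beta>)"]
        unfolding True mult_zero_right by linarith
    qed
    then show ?thesis using True by (simp add: \<beta>_def \<gamma>_def)
  next
    case False
    then have "0 < \<gamma>" using \<open>0 \<le> \<gamma>\<close> by simp
    then have "\<beta>\<^sup>2 \<le> \<alpha> * \<gamma>"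
    proof -
      have "\<alpha> + 2 * (- \<beta> / \<gamma>) * \<beta> + (- \<beta> / \<gamma>)\<^sup>2 * \<gamma> = \<alpha> - \<beta>\<^sup>2 / \<gamma>"
        using False by (simp add: power2_eq_square)
      then have "\<beta>\<^sup>2 / \<gamma> \<le> \<alpha>" using q[of "- \<beta> / \<gamma>"] by simp
      then show ?thesis using \<open>0 < \<gamma>\<close> by (simp add: pos_divide_le_eq)
    qed
    then show ?thesis by (simp add: \<alpha>_def \<beta>_def \<gamma>_def)
  qed
qed

lemma norm_square_le_form:
  assumes C: "symmetric_op C" and pos: "\<And>x. 0 \<le> inner (C x) x"
  shows "(norm (C x))\<^sup>2 \<le> norm C * inner (C x) x"
proof (cases "C x = 0")
  case False
  have "((norm (C x))\<^sup>2)\<^sup>2 \<le> inner (C x) x * inner (C (C x)) (C x)"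
    using form_cauchy_schwarz[OF C pos, of x "C x"] by (simp add: power2_norm_eq_inner)
  also have "inner (C (C x)) (C x) \<le> norm C * norm (C x) * norm (C x)"
    by (rule order_trans[OF norm_cauchy_schwarz mult_right_mono[OF norm_blinfun]]) simp
  finally have "((norm (C x))\<^sup>2)\<^sup>2 \<le> inner (C x) x * (norm C * (norm (C x))\<^sup>2)"
    using pos by (simp add: mult_left_mono power2_eq_square mult.assoc)
  then show ?thesis using False by (simp add: power2_eq_square algebra_simps)
qed (simp add: pos)

lemma norm_le_of_form_le:
  assumes C: "symmetric_op C" and pos: "\<And>x. 0 \<le> inner (C x) x"
    and le: "\<And>x. inner (C x) x \<le> m * (norm x)\<^sup>2" and m: "0 \<le> m"
  shows "norm C \<le> m"
proof (rule norm_blinfun_bound[OF m])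
  fix x
  show "norm (C x) \<le> m * norm x"
  proof (cases "C x = 0")
    case False
    have "((norm (C x))\<^sup>2)\<^sup>2 \<le> inner (C x) x * inner (C (C x)) (C x)"
      using form_cauchy_schwarz[OF C pos, of x "C x"] by (simp add: power2_norm_eq_inner)
    also have "\<dots> \<le> (m * (norm x)\<^sup>2) * (m * (norm (C x))\<^sup>2)"
      using le pos m by (intro mult_mono) auto
    finally have "(norm (C x))\<^sup>2 \<le> (m * norm x)\<^sup>2"
      using False by (simp add: power2_eq_square algebra_simps)
    then show ?thesis by (rule power2_le_imp_le) (use m in simp)
  qed (use m in simp)
qed

text \<open>The supremum of the quadratic form of a symmetric operator is an approximate eigenvalue.\<close>

lemma form_nonpos_of_bounded_below:
  assumes B: "symmetric_op B"
    and bb: "\<And>\<mu>. 0 < \<mu> \<Longrightarrow> \<exists>\<delta>>0. \<forall>x. \<delta> * norm x \<le> norm (B x - \<mu> *\<^sub>R x)"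
  shows "inner (B x) x \<le> 0"
proof -
  define V where "V = (\<lambda>x. inner (B x) x) ` cball 0 1"
  define \<mu> where "\<mu> = Sup V"
  have "inner (B x) x \<le> norm B" if "norm x \<le> 1" for x
  proof -
    have "inner (B x) x \<le> norm (B x) * norm x" by (rule norm_cauchy_schwarz)
    also have "\<dots> \<le> (norm B * norm x) * norm x" by (intro mult_right_mono norm_blinfun) simp
    also have "\<dots> \<le> (norm B * 1) * 1" using that by (intro mult_mono) auto
    finally show ?thesis by simp
  qed
  then have bdd: "bdd_above V" by (auto simp: V_def intro!: bdd_aboveI2)
  have V0: "0 \<in> V" unfolding V_def by (rule image_eqI[of _ _ 0]) auto
  then have "0 \<le> \<mu>" unfolding \<mu>_def using bdd by (rule cSup_upper)
  have le\<mu>: "inner (B x) x \<le> \<mu> * (norm x)\<^sup>2" for x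
  proof (cases "x = 0")
    case False
    define u where "u = (1 / norm x) *\<^sub>R x"
    have "inner (B u) u \<in> V"
      unfolding V_def by (rule image_eqI[OF refl]) (simp add: u_def)
    then have "inner (B u) u \<le> \<mu>" unfolding \<mu>_def using bdd by (rule cSup_upper)
    moreover have "inner (B u) u = inner (B x) x / (norm x)\<^sup>2"
      by (simp add: u_def blinfun.scaleR_right power2_eq_square)
    ultimately show ?thesis using False by (simp add: pos_divide_le_eq)
  qed simp
  have "\<mu> = 0"
  proof (rule ccontr)
    assume "\<mu> \<noteq> 0"
    then have "0 < \<mu>" using \<open>0 \<le> \<mu>\<close> by simp
    from bb[OF this] obtain \<delta> where \<delta>: "0 < \<delta>" "\<And>x. \<delta> * norm x \<le> norm (B x - \<mu> *\<^sub>R x)" by blast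
    define C where "C = \<mu> *\<^sub>R id_blinfun - B"
    have C: "symmetric_op C" unfolding C_def using B by (intro symmetric_op_simps)
    have Cx: "C x = \<mu> *\<^sub>R x - B x" for x by (simp add: C_def blinfun.bilinear_simps)
    have form: "inner (C x) x = \<mu> * (norm x)\<^sup>2 - inner (B x) x" for x
      by (simp add: Cx inner_diff_left power2_norm_eq_inner)
    define \<eta> where "\<eta> = \<delta>\<^sup>2 / (norm C + 1)"
    have \<eta>: "0 < \<eta>" using \<delta>(1) by (simp add: \<eta>_def add_nonneg_pos)
    have "inner (B x) x \<le> max 0 (\<mu> - \<eta>)" if x: "norm x \<le> 1" for x
    proof -
      have "(\<delta> * norm x)\<^sup>2 \<le> (norm (C x))\<^sup>2"
        using \<delta>(1) \<delta>(2)[of x] by (intro power_mono) (auto simp: Cx norm_minus_commute)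
      also have "\<dots> \<le> norm C * inner (C x) x"
        by (rule norm_square_le_form[OF C]) (simp add: form le\<mu>)
      also have "\<dots> \<le> (norm C + 1) * inner (C x) x"
        using le\<mu>[of x] by (intro mult_right_mono) (auto simp: form)
      finally have "\<eta> * (norm x)\<^sup>2 \<le> inner (C x) x"
        by (simp add: \<eta>_def power_mult_distrib pos_divide_le_eq add_nonneg_pos mult.commute)
      then have "inner (B x) x \<le> (\<mu> - \<eta>) * (norm x)\<^sup>2" by (simp add: form left_diff_distrib)
      also have "\<dots> \<le> max 0 (\<mu> - \<eta>) * (norm x)\<^sup>2" by (intro mult_right_mono) auto
      also have "\<dots> \<le> max 0 (\<mu> - \<eta>) * 1"
        using x by (intro mult_left_mono) (auto simp: power_le_one)
      finally show ?thesis by simp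
    qed
    then have "\<mu> \<le> max 0 (\<mu> - \<eta>)"
      unfolding \<mu>_def using V0 by (intro cSup_least) (auto simp: V_def)
    then show False using \<open>0 < \<mu>\<close> \<eta> by simp
  qed
  then show ?thesis using le\<mu>[of x] by simp
qed

lemma form_le_of_bounded_below:
  assumes B: "symmetric_op B"
    and bb: "\<And>\<mu>. m < \<mu> \<Longrightarrow> \<exists>\<delta>>0. \<forall>x. \<delta> * norm x \<le> norm (B x - \<mu> *\<^sub>R x)"
  shows "inner (B x) x \<le> m * (norm x)\<^sup>2"
proof -
  have "inner ((B - m *\<^sub>R id_blinfun) x) x \<le> 0"
  proof (rule form_nonpos_of_bounded_below)
    show "symmetric_op (B - m *\<^sub>R id_blinfun)" using B by (intro symmetric_op_simps)
    fix \<mu> :: real assume "0 < \<mu>"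
    then show "\<exists>\<delta>>0. \<forall>x. \<delta> * norm x \<le> norm ((B - m *\<^sub>R id_blinfun) x - \<mu> *\<^sub>R x)"
      using bb[of "m + \<mu>"] by (simp add: blinfun.bilinear_simps scaleR_left_distrib algebra_simps)
  qed
  then show ?thesis by (simp add: blinfun.bilinear_simps inner_diff_left power2_norm_eq_inner)
qed

lemma bounded_below_of_left_inverse:
  assumes "\<And>x. L (f x) = x" and "\<And>y. norm (L y) \<le> K * norm y"
  shows "\<exists>\<delta>>0. \<forall>x. \<delta> * norm x \<le> norm (f x)"
proof (intro exI[of _ "1 / (\<bar>K\<bar> + 1)"] conjI allI)
  fix x
  have "norm x \<le> K * norm (f x)" using assms(2)[of "f x"] assms(1) by simp
  also have "\<dots> \<le> (\<bar>K\<bar> + 1) * norm (f x)" by (intro mult_right_mono) auto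
  finally show "1 / (\<bar>K\<bar> + 1) * norm x \<le> norm (f x)" by (simp add: pos_divide_le_eq add_nonneg_pos mult.commute)
qed (simp add: add_nonneg_pos)

lemma bounded_below_compose:
  assumes "\<exists>\<delta>>0. \<forall>x. \<delta> * norm x \<le> norm (f x)" "\<exists>\<delta>>0. \<forall>x. \<delta> * norm x \<le> norm (g x)"
  shows "\<exists>\<delta>>(0::real). \<forall>x. \<delta> * norm x \<le> norm (f (g x))"
proof -
  obtain a b where ab: "0 < a" "\<And>x. a * norm x \<le> norm (f x)" "0 < b" "\<And>x. b * norm x \<le> norm (g x)"
    using assms by blast
  have "a * b * norm x \<le> norm (f (g x))" for x
  proof -
    have "a * (b * norm x) \<le> a * norm (g x)" using ab by (intro mult_left_mono) auto
    also have "\<dots> \<le> norm (f (g x))" by (rule ab)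
    finally show ?thesis by (simp add: mult.assoc)
  qed
  then show ?thesis using ab by (intro exI[of _ "a * b"]) simp
qed

lemmas op_distribs =
  bounded_bilinear.add_left[OF bounded_bilinear_blinfun_compose]
  bounded_bilinear.add_right[OF bounded_bilinear_blinfun_compose]
  bounded_bilinear.diff_left[OF bounded_bilinear_blinfun_compose]
  bounded_bilinear.diff_right[OF bounded_bilinear_blinfun_compose]
  bounded_bilinear.minus_left[OF bounded_bilinear_blinfun_compose]
  bounded_bilinear.minus_right[OF bounded_bilinear_blinfun_compose]
  bounded_bilinear.scaleR_left[OF bounded_bilinear_blinfun_compose]
  bounded_bilinear.scaleR_right[OF bounded_bilinear_blinfun_compose]

lemma op_assoc: "(a o\<^sub>L b) o\<^sub>L c = a o\<^sub>L (b o\<^sub>L c)"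
  by (rule blinfun_eqI) simp

lemma op_id [simp]: "id_blinfun o\<^sub>L a = a" "a o\<^sub>L id_blinfun = a"
  by (rule blinfun_eqI, simp)+

lemmas tendsto_compose_op = bounded_bilinear.tendsto[OF bounded_bilinear_blinfun_compose]

locale op_algebra =
  fixes A :: "('h::{real_inner,complete_space} \<Rightarrow>\<^sub>L 'h) set"
  assumes zero_mem: "0 \<in> A"
    and add_mem: "a \<in> A \<Longrightarrow> b \<in> A \<Longrightarrow> a + b \<in> A"
    and scaleR_mem: "a \<in> A \<Longrightarrow> r *\<^sub>R a \<in> A"
    and compose_mem: "a \<in> A \<Longrightarrow> b \<in> A \<Longrightarrow> a o\<^sub>L b \<in> A"
    and closed_carrier: "closed A"
begin

lemma diff_mem: "a \<in> A \<Longrightarrow> b \<in> A \<Longrightarrow> a - b \<in> A"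
  using add_mem[of a "(-1) *\<^sub>R b"] scaleR_mem[of b "-1"] by simp

lemmas mems = zero_mem add_mem diff_mem scaleR_mem compose_mem

lemma limit_mem: "(\<And>k. X k \<in> A) \<Longrightarrow> X \<longlonglongrightarrow> L \<Longrightarrow> L \<in> A"
  using closed_sequentially[OF closed_carrier] by blast

lemma quasi_inverse:
  assumes v: "v \<in> A" and nv: "norm v < 1"
  obtains s where "s \<in> A" "s = v + (v o\<^sub>L s)" "s = v + (s o\<^sub>L v)"
proof -
  define X where "X = rec_nat 0 (\<lambda>_ s. v + (v o\<^sub>L s))"
  have X0: "X 0 = 0" and XS: "X (Suc k) = v + (v o\<^sub>L X k)" for k by (auto simp: X_def)
  have comm: "v o\<^sub>L X k = X k o\<^sub>L v" for k
  proof (induction k)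
    case (Suc k)
    then have "v o\<^sub>L (v o\<^sub>L X k) = (v o\<^sub>L X k) o\<^sub>L v" by (metis op_assoc)
    then show ?case by (simp add: XS op_distribs)
  qed (simp add: X0)
  have mem: "X k \<in> A" for k
    by (induction k) (auto simp: X0 XS intro: mems v)
  have "norm (X (Suc k) - X k) \<le> norm v * norm v ^ k" for k
  proof (induction k)
    case (Suc k)
    have "X (Suc (Suc k)) - X (Suc k) = v o\<^sub>L (X (Suc k) - X k)"
      by (simp add: XS[of "Suc k"] XS[of k] op_distribs)
    then have "norm (X (Suc (Suc k)) - X (Suc k)) \<le> norm v * norm (X (Suc k) - X k)"
      by (simp add: norm_blinfun_compose)
    also have "\<dots> \<le> norm v * (norm v * norm v ^ k)" using Suc by (intro mult_left_mono) auto
    finally show ?case by simp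
  qed (simp add: X0 XS)
  then obtain s where s: "X \<longlonglongrightarrow> s" using blinfun_geometric_limit nv norm_ge_zero by metis
  have "(\<lambda>k. X (Suc k)) \<longlonglongrightarrow> v + (v o\<^sub>L s)"
    unfolding XS by (intro tendsto_add tendsto_compose_op tendsto_const s)
  moreover have "(\<lambda>k. X (Suc k)) \<longlonglongrightarrow> v + (s o\<^sub>L v)"
    unfolding XS comm by (intro tendsto_add tendsto_compose_op tendsto_const s)
  moreover have "(\<lambda>k. X (Suc k)) \<longlonglongrightarrow> s" using s by (simp add: LIMSEQ_Suc)
  ultimately show ?thesis using that LIMSEQ_unique limit_mem[OF mem s] by metis
qed

text \<open>\<open>Z\<close> is \<open>e\<close> minus the square root of \<open>e - Y\<close>, found as a fixed point of Visser's iteration.\<close>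

lemma square_root:
  assumes Y: "Y \<in> A" "symmetric_op Y" "norm Y \<le> t" and t: "t < 1"
  obtains Z where "Z \<in> A" "symmetric_op Z" "norm Z < 1" "2 *\<^sub>R Z = Y + (Z o\<^sub>L Z)"
    "\<And>a. a o\<^sub>L Y = Y o\<^sub>L a \<Longrightarrow> a o\<^sub>L Z = Z o\<^sub>L a"
    "\<And>e. e o\<^sub>L Y = Y \<Longrightarrow> e o\<^sub>L Z = Z"
proof -
  define \<rho> where "\<rho> = 1 - sqrt (1 - t)"
  have t0: "0 \<le> t" using Y(3) norm_ge_zero order_trans by blast
  have "(1 - \<rho>)\<^sup>2 = 1 - t" using t by (simp add: \<rho>_def)
  then have \<rho>fix: "(t + \<rho> * \<rho>) / 2 = \<rho>" by (simp add: power2_eq_square algebra_simps)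
  have \<rho>: "0 \<le> \<rho>" "\<rho> < 1" using t t0 by (auto simp: \<rho>_def)
  define X where "X = rec_nat 0 (\<lambda>_ z. (1/2) *\<^sub>R (Y + (z o\<^sub>L z)))"
  have X0: "X 0 = 0" and XS: "X (Suc k) = (1/2) *\<^sub>R (Y + (X k o\<^sub>L X k))" for k by (auto simp: X_def)
  have mem: "X k \<in> A" for k by (induction k) (auto simp: X0 XS intro: mems Y)
  have sym: "symmetric_op (X k)" for k
    by (induction k) (auto simp: X0 XS intro!: symmetric_op_simps symmetric_op_compose Y)
  have comm: "a o\<^sub>L X k = X k o\<^sub>L a" if "a o\<^sub>L Y = Y o\<^sub>L a" for a k
  proof (induction k)
    case (Suc k)
    then have "a o\<^sub>L (X k o\<^sub>L X k) = (X k o\<^sub>L X k) o\<^sub>L a" by (metis op_assoc)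
    then show ?case using that by (simp add: XS op_distribs)
  qed (simp add: X0)
  have unit: "e o\<^sub>L X k = X k" if "e o\<^sub>L Y = Y" for e k
    by (induction k) (auto simp: X0 XS op_distribs that simp flip: op_assoc)
  have nX: "norm (X k) \<le> \<rho>" for k
  proof (induction k)
    case (Suc k)
    have "norm (X k o\<^sub>L X k) \<le> \<rho> * \<rho>"
      by (rule order_trans[OF norm_blinfun_compose mult_mono]) (use Suc \<rho> in auto)
    then have "norm (Y + (X k o\<^sub>L X k)) \<le> t + \<rho> * \<rho>"
      using Y(3) norm_triangle_mono by blast
    then show ?case using \<rho>fix by (simp add: XS)
  qed (use \<rho> X0 in simp)
  have "norm (X (Suc k) - X k) \<le> 1 * \<rho> ^ k" for k
  proof (induction k)
    case 0
    show ?case using nX[of 1] \<rho> by (simp add: X0)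
  next
    case (Suc k)
    have "X (Suc (Suc k)) - X (Suc k)
      = (1/2) *\<^sub>R ((X (Suc k) o\<^sub>L (X (Suc k) - X k)) + ((X (Suc k) - X k) o\<^sub>L X k))"
      by (simp add: XS[of "Suc k"] XS[of k] op_distribs scaleR_right_diff_distrib scaleR_right_distrib)
    moreover have "norm ((X (Suc k) o\<^sub>L (X (Suc k) - X k)) + ((X (Suc k) - X k) o\<^sub>L X k))
        \<le> \<rho> * \<rho> ^ k + \<rho> ^ k * \<rho>"
      using Suc \<rho> nX
      by (intro norm_triangle_mono order_trans[OF norm_blinfun_compose mult_mono]) auto
    ultimately show ?case by simp
  qed
  then obtain Z where Z: "X \<longlonglongrightarrow> Z" using blinfun_geometric_limit \<rho> by metis
  have XSZ: "(\<lambda>k. X (Suc k)) \<longlonglongrightarrow> Z" using Z by (simp add: LIMSEQ_Suc)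
  moreover have "(\<lambda>k. X (Suc k)) \<longlonglongrightarrow> (1/2) *\<^sub>R (Y + (Z o\<^sub>L Z))"
    unfolding XS by (intro tendsto_intros tendsto_compose_op Z)
  ultimately have "Z = (1/2) *\<^sub>R (Y + (Z o\<^sub>L Z))" using LIMSEQ_unique by blast
  then have fixed: "2 *\<^sub>R Z = Y + (Z o\<^sub>L Z)" by (metis scaleR_half_double scaleR_2 scaleR_right_distrib)
  have nZ: "norm Z \<le> \<rho>" by (rule LIMSEQ_le_const2[OF tendsto_norm[OF Z]]) (use nX in auto)
  have cZ: "a o\<^sub>L Z = Z o\<^sub>L a" if "a o\<^sub>L Y = Y o\<^sub>L a" for a
  proof -
    have "(\<lambda>k. a o\<^sub>L X k) \<longlonglongrightarrow> (a o\<^sub>L Z)" "(\<lambda>k. X k o\<^sub>L a) \<longlonglongrightarrow> (Z o\<^sub>L a)"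
      by (intro tendsto_compose_op tendsto_const Z)+
    then show ?thesis unfolding comm[OF that] by (rule LIMSEQ_unique)
  qed
  have uZ: "e o\<^sub>L Z = Z" if "e o\<^sub>L Y = Y" for e
  proof -
    have "(\<lambda>k. e o\<^sub>L X k) \<longlonglongrightarrow> (e o\<^sub>L Z)" by (intro tendsto_compose_op tendsto_const Z)
    then show ?thesis unfolding unit[OF that] using Z by (rule LIMSEQ_unique)
  qed
  show ?thesis
    by (rule that[OF limit_mem[OF mem Z] symmetric_op_limit[OF sym Z] _ fixed cZ uZ])
      (use nZ \<rho> in auto)
qed

end

section \<open>Projections in algebras of real rank zero\<close>

lemma compose_eqD: "a o\<^sub>L b = c \<Longrightarrow> a (b x) = c x"
  by auto

lemma symmetric_op_compose_commute:
  assumes "symmetric_op a" "symmetric_op b" "symmetric_op (a o\<^sub>L b)"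
  shows "b o\<^sub>L a = a o\<^sub>L b"
proof (rule symmetric_op_unique)
  fix x y
  show "inner ((b o\<^sub>L a) x) y = inner ((a o\<^sub>L b) x) y"
    using assms by (metis blinfun_apply_blinfun_compose symmetric_opD)
qed

lemma symmetric_op_right_inverse:
  assumes h: "symmetric_op h" and e: "symmetric_op e" and hg: "h o\<^sub>L g = e" and eg: "e o\<^sub>L g = g"
  shows "symmetric_op g"
  unfolding symmetric_op_def
proof (intro allI)
  fix x y
  have "inner (g x) y = inner (g x) (e y)"
    using symmetric_opD[OF e, of "g x" y] compose_eqD[OF eg, of x] by simp
  also have "\<dots> = inner (e x) (g y)"
    using symmetric_opD[OF h, of "g x" "g y"] compose_eqD[OF hg] by simp
  also have "\<dots> = inner x (g y)"
    using symmetric_opD[OF e, of x "g y"] compose_eqD[OF eg, of y] by simp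
  finally show "inner (g x) y = inner x (g y)" .
qed

definition is_projection :: "('h::real_inner \<Rightarrow>\<^sub>L 'h) \<Rightarrow> bool" where
  "is_projection P \<longleftrightarrow> symmetric_op P \<and> P o\<^sub>L P = P"

lemma is_projectionD:
  assumes "is_projection P"
  shows "symmetric_op P" "P o\<^sub>L P = P" "P (P x) = P x" "inner (P x) y = inner x (P y)"
  using assms by (auto simp: is_projection_def symmetric_opD dest: compose_eqD)

lemma projection_pythagoras:
  assumes "is_projection P"
  shows "(norm x)\<^sup>2 = (norm (P x))\<^sup>2 + (norm (x - P x))\<^sup>2"
  using is_projectionD(3,4)[OF assms]
  by (simp add: power2_norm_eq_inner inner_diff inner_commute)

lemma projection_form: "is_projection P \<Longrightarrow> inner (P x) x = (norm (P x))\<^sup>2"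
  by (metis is_projectionD(3,4) power2_norm_eq_inner)

lemma projection_norm_le:
  assumes "is_projection P"
  shows "norm (P x) \<le> norm x"
  by (rule power2_le_imp_le) (simp_all add: projection_pythagoras[OF assms, of x])

lemma projection_fixed_of_norm:
  assumes "is_projection P" "norm x \<le> norm (P x)"
  shows "P x = x"
proof -
  have "norm (P x) = norm x" using assms projection_norm_le by (intro antisym)
  then show ?thesis using projection_pythagoras[OF assms(1), of x] by simp
qed

lemma is_projection_diff:
  assumes "is_projection P" "is_projection Q" "P o\<^sub>L Q = Q"
  shows "is_projection (P - Q)"
proof -
  have "Q o\<^sub>L P = Q"
    using symmetric_op_compose_commute[of P Q] assms is_projectionD(1) by metis
  then show ?thesis
    using assms by (auto simp: is_projection_def op_distribs)
qed

lemma is_projection_id: "is_projection id_blinfun"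
  by (auto simp: is_projection_def)

context op_algebra
begin

lemma sign_operator:
  assumes e: "e \<in> A" "is_projection e" and b: "b \<in> A" "symmetric_op b"
    and eb: "e o\<^sub>L b = b" and \<delta>: "0 < \<delta>" "\<And>x. \<delta> * (norm (e x))\<^sup>2 \<le> (norm (b x))\<^sup>2"
  obtains X where "X \<in> A" "symmetric_op X" "X o\<^sub>L X = e" "e o\<^sub>L X = X" "\<And>x. 0 \<le> inner (b (X x)) x"
proof -
  have be: "b o\<^sub>L e = b"
    using symmetric_op_compose_commute[of e b] b eb is_projectionD(1)[OF e(2)] by simp
  define K where "K = norm b + 1"
  have K: "0 < K" by (simp add: K_def add_nonneg_pos)
  define Y where "Y = e - (1 / K\<^sup>2) *\<^sub>R (b o\<^sub>L b)"
  define t where "t = max 0 (1 - \<delta> / K\<^sup>2)"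
  have Yform: "inner (Y x) x = (norm (e x))\<^sup>2 - (norm (b x))\<^sup>2 / K\<^sup>2" for x
    using projection_form[OF e(2), of x] symmetric_opD[OF b(2), of "b x" x]
    by (simp add: Y_def blinfun.bilinear_simps inner_diff_left power2_norm_eq_inner)
  have bK: "(norm (b x))\<^sup>2 \<le> K\<^sup>2 * (norm (e x))\<^sup>2" for x
  proof -
    have "norm (b x) \<le> norm b * norm (e x)" using norm_blinfun[of b "e x"] compose_eqD[OF be] by simp
    also have "\<dots> \<le> K * norm (e x)" by (intro mult_right_mono) (auto simp: K_def)
    finally show ?thesis by (metis norm_ge_zero power_mono power_mult_distrib)
  qed
  have Ypos: "0 \<le> inner (Y x) x" for x
    using bK[of x] K by (simp add: Yform pos_divide_le_eq mult.commute)
  have Yle: "inner (Y x) x \<le> t * (norm x)\<^sup>2" for x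
  proof -
    have "inner (Y x) x \<le> (1 - \<delta> / K\<^sup>2) * (norm (e x))\<^sup>2"
      using divide_right_mono[OF \<delta>(2)[of x], of "K\<^sup>2"] by (simp add: Yform left_diff_distrib)
    also have "\<dots> \<le> t * (norm (e x))\<^sup>2" by (intro mult_right_mono) (auto simp: t_def)
    also have "\<dots> \<le> t * (norm x)\<^sup>2"
      using projection_norm_le[OF e(2)] by (intro mult_left_mono power_mono) (auto simp: t_def)
    finally show ?thesis .
  qed
  have YA: "Y \<in> A" unfolding Y_def by (intro mems e b)
  have Ysym: "symmetric_op Y" unfolding Y_def
    using b(2) is_projectionD(1)[OF e(2)] by (intro symmetric_op_simps symmetric_op_compose) auto
  have nY: "norm Y \<le> t" by (rule norm_le_of_form_le[OF Ysym Ypos Yle]) (simp add: t_def)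
  have "t < 1" using \<delta>(1) K by (simp add: t_def)
  from square_root[OF YA Ysym nY this] obtain Z where Z: "Z \<in> A" "symmetric_op Z" "norm Z < 1"
    "2 *\<^sub>R Z = Y + (Z o\<^sub>L Z)" "\<And>a. a o\<^sub>L Y = Y o\<^sub>L a \<Longrightarrow> a o\<^sub>L Z = Z o\<^sub>L a"
    "\<And>e. e o\<^sub>L Y = Y \<Longrightarrow> e o\<^sub>L Z = Z" by blast
  have ee: "e o\<^sub>L e = e" using e(2) is_projectionD(2) by blast
  have eY: "e o\<^sub>L Y = Y" by (simp add: Y_def op_distribs ee eb flip: op_assoc)
  have Ye: "Y o\<^sub>L e = Y" by (simp add: Y_def op_distribs ee be op_assoc)
  have eZ: "e o\<^sub>L Z = Z" by (rule Z(6)[OF eY])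
  have Ze: "Z o\<^sub>L e = Z" using Z(5)[of e] eY Ye eZ by simp
  have bZ: "b o\<^sub>L Z = Z o\<^sub>L b" by (rule Z(5)) (simp add: Y_def op_distribs be eb op_assoc)
  from quasi_inverse[OF Z(1,3)] obtain s
    where s: "s \<in> A" "s = Z + (Z o\<^sub>L s)" "s = Z + (s o\<^sub>L Z)" by blast
  have es: "e o\<^sub>L s = s"
  proof -
    have "e o\<^sub>L s = (e o\<^sub>L Z) + ((e o\<^sub>L Z) o\<^sub>L s)" by (subst s(2)) (simp add: op_distribs op_assoc)
    then show ?thesis using s(2) eZ by simp
  qed
  have se: "s o\<^sub>L e = s"
  proof -
    have "s o\<^sub>L e = (Z o\<^sub>L e) + (s o\<^sub>L (Z o\<^sub>L e))" by (subst s(3)) (simp add: op_distribs op_assoc)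
    then show ?thesis using s(3) Ze by simp
  qed
  have s': "s - (Z o\<^sub>L s) = Z"
    using s(2) by (metis add_diff_cancel_right')
  define h g where "h = e - Z" and "g = e + s"
  have hg: "h o\<^sub>L g = e"
    using s' by (simp add: h_def g_def op_distribs ee es Ze)
  have gh: "g o\<^sub>L h = e"
    using s(3) by (simp add: h_def g_def op_distribs ee se eZ)
  have eg: "e o\<^sub>L g = g" by (simp add: g_def op_distribs ee es)
  have hsym: "symmetric_op h" unfolding h_def using Z(2) is_projectionD(1)[OF e(2)] by (intro symmetric_op_simps)
  have gsym: "symmetric_op g" by (rule symmetric_op_right_inverse[OF hsym _ hg eg]) (use e is_projectionD in blast)
  have bh: "b o\<^sub>L h = h o\<^sub>L b" by (simp add: h_def op_distribs bZ be eb)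
  have bg: "b o\<^sub>L g = g o\<^sub>L b"
  proof (rule blinfun_eqI)
    fix x
    have "g (b x) = g (b (h (g x)))" using compose_eqD[OF be] compose_eqD[OF hg] by simp
    also have "\<dots> = g (h (b (g x)))" using compose_eqD[OF bh] by simp
    also have "\<dots> = b (g x)" using compose_eqD[OF gh] compose_eqD[OF eb] by simp
    finally show "(b o\<^sub>L g) x = (g o\<^sub>L b) x" by simp
  qed
  have hh: "h o\<^sub>L h = (1 / K\<^sup>2) *\<^sub>R (b o\<^sub>L b)"
  proof -
    have "h o\<^sub>L h = e - 2 *\<^sub>R Z + (Z o\<^sub>L Z)" by (simp add: h_def op_distribs ee eZ Ze scaleR_2)
    then show ?thesis unfolding Z(4) by (simp add: Y_def)
  qed
  define X where "X = (1 / K) *\<^sub>R (b o\<^sub>L g)"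
  show ?thesis
  proof
    show "X \<in> A" unfolding X_def g_def by (intro mems e b s)
    show "symmetric_op X" unfolding X_def using b(2) gsym bg by (intro symmetric_op_simps symmetric_op_compose)
    show "e o\<^sub>L X = X" by (simp add: X_def op_distribs eb flip: op_assoc)
    show "X o\<^sub>L X = e"
    proof (rule blinfun_eqI)
      fix x
      have "(X o\<^sub>L X) x = (1 / K\<^sup>2) *\<^sub>R b (b (g (g x)))"
        using compose_eqD[OF bg] by (simp add: X_def blinfun.bilinear_simps power2_eq_square)
      also have "\<dots> = h (h (g (g x)))" using compose_eqD[OF hh, of "g (g x)"] by (simp add: blinfun.bilinear_simps)
      also have "\<dots> = e x" using compose_eqD[OF hg] compose_eqD[OF eg] by simp
      finally show "(X o\<^sub>L X) x = e x" .
    qed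
    show "0 \<le> inner (b (X x)) x" for x
    proof -
      have "b (X x) = K *\<^sub>R ((1 / K\<^sup>2) *\<^sub>R b (b (g x)))"
        using K by (simp add: X_def blinfun.bilinear_simps power2_eq_square)
      also have "(1 / K\<^sup>2) *\<^sub>R b (b (g x)) = h (h (g x))"
        using compose_eqD[OF hh, of "g x"] by (simp add: blinfun.bilinear_simps)
      also have "\<dots> = h (e x)" using compose_eqD[OF hg] by simp
      finally have "inner (b (X x)) x = K * inner (h (e x)) x" by simp
      moreover have "inner (h (e x)) x = inner (h x) x"
        using compose_eqD[OF Ze] compose_eqD[OF ee] by (simp add: h_def blinfun.bilinear_simps)
      moreover have "0 \<le> inner (h x) x"
      proof -
        have "inner (Z x) x = inner (Z (e x)) (e x)"
          using compose_eqD[OF Ze, of x] compose_eqD[OF eZ, of x] symmetric_opD[of e "Z x" x]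
            is_projectionD(1)[OF e(2)] by simp
        also have "\<dots> \<le> norm (Z (e x)) * norm (e x)" by (rule norm_cauchy_schwarz)
        also have "\<dots> \<le> (norm Z * norm (e x)) * norm (e x)"
          by (intro mult_right_mono norm_blinfun) simp
        also have "\<dots> \<le> (1 * norm (e x)) * norm (e x)" using Z(3) by (intro mult_right_mono) auto
        finally show ?thesis using projection_form[OF e(2), of x]
          by (simp add: h_def blinfun.bilinear_simps inner_diff_left power2_eq_square)
      qed
      ultimately show ?thesis using K by simp
    qed
  qed
qed

end

locale unital_real_rank_zero = op_algebra +
  fixes e
  assumes unit_mem: "e \<in> A" and unit_projection: "is_projection e"
    and unit_left: "a \<in> A \<Longrightarrow> e o\<^sub>L a = a" and unit_right: "a \<in> A \<Longrightarrow> a o\<^sub>L e = a"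
    and real_rank_zero: "a \<in> A \<Longrightarrow> symmetric_op a \<Longrightarrow> 0 < \<epsilon> \<Longrightarrow>
      \<exists>b\<in>A. symmetric_op b \<and> norm (a - b) < \<epsilon> \<and> (\<exists>\<delta>>0. \<forall>x. \<delta> * norm (e x) \<le> norm (b x))"
begin

text \<open>
  With \<open>q\<close> an approximate spectral projection of \<open>c\<^sup>2\<close> away from \<open>0\<close>, the projection onto the range of
  \<open>c q\<close> is \<open>c (q c\<^sup>2 q)\<^sup>-\<^sup>1 c\<close>, the inverse being taken in the corner of \<open>q\<close>.
\<close>

lemma range_projection:
  assumes c: "c \<in> A" "symmetric_op c" and \<epsilon>: "0 < \<epsilon>"
  obtains z where "z \<in> A" "is_projection (c o\<^sub>L z o\<^sub>L c)" "norm (c - (c o\<^sub>L z o\<^sub>L c o\<^sub>L c)) \<le> \<epsilon>"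
proof -
  define \<eta> where "\<eta> = \<epsilon>\<^sup>2 / 2"
  have \<eta>: "0 < \<eta>" using \<epsilon> by (simp add: \<eta>_def)
  define a where "a = (c o\<^sub>L c) - \<eta> *\<^sub>R e"
  have aA: "a \<in> A" unfolding a_def by (intro mems c unit_mem)
  have asym: "symmetric_op a" unfolding a_def using c(2) is_projectionD(1)[OF unit_projection]
    by (intro symmetric_op_simps symmetric_op_compose) auto
  from real_rank_zero[OF aA asym, of "\<eta> / 2"] \<eta> obtain b \<delta>
    where b: "b \<in> A" "symmetric_op b" "norm (a - b) < \<eta> / 2"
      and \<delta>: "0 < \<delta>" "\<And>x. \<delta> * norm (e x) \<le> norm (b x)" by auto
  have "\<delta>\<^sup>2 * (norm (e x))\<^sup>2 \<le> (norm (b x))\<^sup>2" for x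
    using power_mono[OF \<delta>(2)[of x], of 2] \<delta>(1) by (simp add: power_mult_distrib)
  then obtain X where X: "X \<in> A" "symmetric_op X" "X o\<^sub>L X = e" "e o\<^sub>L X = X"
      "\<And>x. 0 \<le> inner (b (X x)) x"
    using sign_operator[OF unit_mem unit_projection b(1,2) unit_left[OF b(1)], of "\<delta>\<^sup>2"] \<delta>(1) by auto
  define q where "q = (1/2) *\<^sub>R (e + X)"
  have Xe: "X o\<^sub>L e = X" by (rule unit_right[OF X(1)])
  have ee: "e o\<^sub>L e = e" by (rule unit_left[OF unit_mem])
  have qA: "q \<in> A" unfolding q_def by (intro mems unit_mem X)
  have eq: "e o\<^sub>L q = q" by (rule unit_left[OF qA])
  have "(e + X) o\<^sub>L (e + X) = 2 *\<^sub>R (e + X)"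
    by (simp add: op_distribs X Xe ee scaleR_2 algebra_simps)
  then have "q o\<^sub>L q = q" by (simp add: q_def op_distribs(7,8))
  moreover have "symmetric_op q" unfolding q_def
    using X(2) is_projectionD(1)[OF unit_projection] by (intro symmetric_op_simps)
  ultimately have q: "is_projection q" by (simp add: is_projection_def)
  have Xq: "X (q x) = q x" for x
    using compose_eqD[OF X(3)] compose_eqD[OF Xe] by (simp add: q_def blinfun.bilinear_simps add.commute)
  have eq': "is_projection (e - q)" by (rule is_projection_diff[OF unit_projection q eq])
  have Xeq: "X ((e - q) x) = - (e - q) x" for x
    using compose_eqD[OF Xe, of x] Xq[of x]
    by (simp add: q_def blinfun.bilinear_simps scaleR_right_distrib algebra_simps flip: scaleR_left_distrib)
  have ccform: "(norm (c u))\<^sup>2 = inner (a u) u + \<eta> * (norm (e u))\<^sup>2" for u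
    using projection_form[OF unit_projection, of u] symmetric_opD[OF c(2), of "c u" u]
    by (simp add: a_def blinfun.bilinear_simps inner_diff_left power2_norm_eq_inner)
  have near: "\<bar>inner (a u) u - inner (b u) u\<bar> \<le> \<eta> / 2 * (norm u)\<^sup>2" for u
  proof -
    have "inner (a u) u - inner (b u) u = inner ((a - b) u) u"
      by (simp add: blinfun.bilinear_simps inner_diff_left)
    also have "\<bar>\<dots>\<bar> \<le> norm ((a - b) u) * norm u" by (rule Cauchy_Schwarz_ineq2)
    also have "\<dots> \<le> (norm (a - b) * norm u) * norm u" by (intro mult_right_mono norm_blinfun) simp
    also have "\<dots> \<le> (\<eta> / 2 * norm u) * norm u" using b(3) by (intro mult_right_mono) auto
    finally show ?thesis by (simp add: power2_eq_square)
  qed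
  have lower: "\<eta> / 2 * (norm (q x))\<^sup>2 \<le> (norm (c (q x)))\<^sup>2" for x
    using near[of "q x"] ccform[of "q x"] X(5)[of "q x"]
    unfolding Xq compose_eqD[OF eq] by linarith
  have upper: "norm (c ((e - q) x)) \<le> \<epsilon> * norm x" for x
  proof -
    define u where "u = (e - q) x"
    have "X u = - u" unfolding u_def by (rule Xeq)
    then have "inner (b u) u \<le> 0" using X(5)[of u] by (simp add: blinfun.minus_right)
    then have "(norm (c u))\<^sup>2 \<le> \<eta> / 2 * (norm u)\<^sup>2 + \<eta> * (norm (e u))\<^sup>2"
      using near[of u] ccform[of u] by linarith
    also have "\<dots> \<le> \<eta> / 2 * (norm u)\<^sup>2 + \<eta> * (norm u)\<^sup>2"
      using \<eta> projection_norm_le[OF unit_projection] by (intro add_left_mono mult_left_mono power_mono) auto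
    also have "\<dots> \<le> \<epsilon>\<^sup>2 * (norm u)\<^sup>2" by (simp add: \<eta>_def)
    also have "\<dots> \<le> \<epsilon>\<^sup>2 * (norm x)\<^sup>2"
      unfolding u_def using projection_norm_le[OF eq'] by (intro mult_left_mono power_mono) auto
    finally have "(norm (c u))\<^sup>2 \<le> (\<epsilon> * norm x)\<^sup>2" by (simp add: power_mult_distrib)
    then show ?thesis unfolding u_def by (rule power2_le_imp_le) (use \<epsilon> in simp)
  qed
  define w where "w = q o\<^sub>L (c o\<^sub>L c) o\<^sub>L q"
  define K where "K = (norm c)\<^sup>2 + \<eta>"
  have K: "0 < K" "\<eta> \<le> K" using \<eta> by (auto simp: K_def add_nonneg_pos)
  define v where "v = q - (1 / K) *\<^sub>R w"
  have wA: "w \<in> A" unfolding w_def by (intro mems qA c)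
  have wsym: "symmetric_op w" unfolding w_def
    by (intro symmetric_op_conj symmetric_op_compose c is_projectionD(1)[OF q]) simp
  have vA: "v \<in> A" unfolding v_def by (intro mems wA qA)
  have vsym: "symmetric_op v" unfolding v_def by (intro symmetric_op_simps wsym is_projectionD(1)[OF q])
  have wform: "inner (w x) x = (norm (c (q x)))\<^sup>2" for x
    by (simp add: w_def is_projectionD(4)[OF q] symmetric_opD[OF c(2)] power2_norm_eq_inner)
  have vform: "inner (v x) x = (norm (q x))\<^sup>2 - (norm (c (q x)))\<^sup>2 / K" for x
    by (simp add: v_def blinfun.bilinear_simps inner_diff_left projection_form[OF q] wform)
  have nv: "norm v \<le> 1 - \<eta> / (2 * K)"
  proof (rule norm_le_of_form_le[OF vsym])
    fix x
    have "norm (c (q x)) \<le> norm c * norm (q x)" by (rule norm_blinfun)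
    then have "(norm (c (q x)))\<^sup>2 \<le> (norm c)\<^sup>2 * (norm (q x))\<^sup>2"
      by (metis norm_ge_zero power_mono power_mult_distrib)
    also have "\<dots> \<le> K * (norm (q x))\<^sup>2" using \<eta> by (intro mult_right_mono) (auto simp: K_def)
    finally show "0 \<le> inner (v x) x" using K by (simp add: vform pos_divide_le_eq mult.commute)
    have "inner (v x) x \<le> (1 - \<eta> / (2 * K)) * (norm (q x))\<^sup>2"
      using divide_right_mono[OF lower[of x], of K] K by (simp add: vform left_diff_distrib)
    also have "\<dots> \<le> (1 - \<eta> / (2 * K)) * (norm x)\<^sup>2"
      using projection_norm_le[OF q] K \<eta> by (intro mult_left_mono power_mono) (auto simp: divide_le_eq)
    finally show "inner (v x) x \<le> (1 - \<eta> / (2 * K)) * (norm x)\<^sup>2" .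
  qed (use K \<eta> in \<open>auto simp: divide_le_eq\<close>)
  have "norm v < 1" using nv K \<eta> by (smt (verit) divide_pos_pos)
  from quasi_inverse[OF vA this] obtain s
    where s: "s \<in> A" "s = v + (v o\<^sub>L s)" "s = v + (s o\<^sub>L v)" by blast
  have qq: "q o\<^sub>L q = q" by (rule is_projectionD(2)[OF q])
  have qw: "q o\<^sub>L w = w" by (simp add: w_def qq flip: op_assoc)
  have wq: "w o\<^sub>L q = w" by (simp add: w_def qq op_assoc)
  have qv: "q o\<^sub>L v = v" by (simp add: v_def op_distribs qq qw)
  have vq: "v o\<^sub>L q = v" by (simp add: v_def op_distribs qq wq)
  have qs: "q o\<^sub>L s = s"
  proof -
    have "q o\<^sub>L s = (q o\<^sub>L v) + ((q o\<^sub>L v) o\<^sub>L s)" by (subst s(2)) (simp add: op_distribs op_assoc)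
    then show ?thesis using s(2) qv by simp
  qed
  have sq: "s o\<^sub>L q = s"
  proof -
    have "s o\<^sub>L q = (v o\<^sub>L q) + (s o\<^sub>L (v o\<^sub>L q))" by (subst s(3)) (simp add: op_distribs op_assoc)
    then show ?thesis using s(3) vq by simp
  qed
  have s': "s - (v o\<^sub>L s) = v"
    using s(2) by (metis add_diff_cancel_right')
  define z where "z = (1 / K) *\<^sub>R (q + s)"
  have zA: "z \<in> A" unfolding z_def by (intro mems qA s)
  have w_eq: "w = K *\<^sub>R (q - v)" using K by (simp add: v_def)
  have wz: "w o\<^sub>L z = q"
  proof -
    have "(q - v) o\<^sub>L (q + s) = q" using s' by (simp add: op_distribs qq qs vq)
    then show ?thesis using K by (simp add: w_eq z_def op_distribs(7,8))
  qed
  have zw: "z o\<^sub>L w = q"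
  proof -
    have "(q + s) o\<^sub>L (q - v) = q" using s(3) by (simp add: op_distribs qq sq qv)
    then show ?thesis using K by (simp add: w_eq z_def op_distribs(7,8))
  qed
  have qz: "q o\<^sub>L z = z" by (simp add: z_def op_distribs qq qs)
  have zq: "z o\<^sub>L q = z" by (simp add: z_def op_distribs qq sq)
  have zsym: "symmetric_op z"
    by (rule symmetric_op_right_inverse[OF wsym is_projectionD(1)[OF q] wz qz])
  define Q where "Q = c o\<^sub>L z o\<^sub>L c"
  have zccz: "z (c (c (z x))) = z x" for x
  proof -
    have "z (c (c (z x))) = z (w (z x))"
      using compose_eqD[OF zq] compose_eqD[OF qz] by (simp add: w_def)
    then show ?thesis using compose_eqD[OF wz] compose_eqD[OF zq] by simp
  qed
  have Qcq: "Q (c (q x)) = c (q x)" for x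
  proof -
    have "z (c (c (q x))) = z (w x)" using compose_eqD[OF zq] by (simp add: w_def)
    then show ?thesis using compose_eqD[OF zw] by (simp add: Q_def)
  qed
  have Q: "is_projection Q" unfolding is_projection_def
  proof
    show "symmetric_op Q" unfolding Q_def by (rule symmetric_op_conj[OF c(2) zsym])
    show "Q o\<^sub>L Q = Q" by (rule blinfun_eqI) (simp add: Q_def zccz)
  qed
  have "norm (c - (Q o\<^sub>L c)) \<le> \<epsilon>"
  proof (rule norm_blinfun_bound)
    fix x
    define u where "u = c ((e - q) x)"
    have "c x = c (q x) + u"
      using compose_eqD[OF unit_right[OF c(1)], of x] by (simp add: u_def blinfun.bilinear_simps)
    then have "(c - (Q o\<^sub>L c)) x = u - Q u"
      by (simp add: blinfun.bilinear_simps Qcq)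
    moreover have "norm (u - Q u) \<le> norm u"
      by (rule power2_le_imp_le) (simp_all add: projection_pythagoras[OF Q, of u])
    ultimately show "norm ((c - (Q o\<^sub>L c)) x) \<le> \<epsilon> * norm x"
      using upper[of x] by (simp add: u_def)
  qed (use \<epsilon> in simp)
  then show ?thesis using that[OF zA] Q by (simp add: Q_def op_assoc)
qed

lemma decreasing_projections:
  assumes d: "d \<in> A" "symmetric_op d"
    and dy: "(\<lambda>k. d (y k)) \<longlonglongrightarrow> 0" and ey: "(\<lambda>k. e (y k) - y k) \<longlonglongrightarrow> 0"
  obtains E :: "nat \<Rightarrow> 'a \<Rightarrow>\<^sub>L 'a"
    where "\<And>n. E n \<in> A" "\<And>n. is_projection (E n)" "\<And>n. E (Suc n) o\<^sub>L E n = E (Suc n)"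
      "\<And>n. (\<lambda>k. E n (y k) - y k) \<longlonglongrightarrow> 0"
      "(\<lambda>n. norm (E n o\<^sub>L d o\<^sub>L E n)) \<longlonglongrightarrow> 0"
proof -
  define good where "good n E \<longleftrightarrow> E \<in> A \<and> is_projection E \<and> (\<lambda>k. E (y k) - y k) \<longlonglongrightarrow> 0 \<and>
    (n \<noteq> 0 \<longrightarrow> norm (E o\<^sub>L d o\<^sub>L E) \<le> 1 / real n)" for n E
  have "good 0 e" using ey by (simp add: good_def unit_mem unit_projection)
  moreover have "\<exists>F. good (Suc n) F \<and> F o\<^sub>L E = F" if "good n E" for n E
  proof -
    have E: "E \<in> A" "is_projection E" and Ey: "(\<lambda>k. E (y k) - y k) \<longlonglongrightarrow> 0"
      using that by (auto simp: good_def)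
    have EE: "E (E x) = E x" for x by (rule is_projectionD(3)[OF E(2)])
    define c where "c = E o\<^sub>L d o\<^sub>L E"
    have c: "c \<in> A" "symmetric_op c" unfolding c_def
      by (auto intro!: mems E d symmetric_op_conj is_projectionD(1)[OF E(2)])
    from range_projection[OF c, of "1 / real (Suc n)"] obtain z where z: "z \<in> A"
        "is_projection (c o\<^sub>L z o\<^sub>L c)" "norm (c - (c o\<^sub>L z o\<^sub>L c o\<^sub>L c)) \<le> 1 / real (Suc n)"
      by auto
    define Q where "Q = c o\<^sub>L z o\<^sub>L c"
    have EQ: "E o\<^sub>L Q = Q" by (rule blinfun_eqI) (simp add: Q_def c_def EE)
    have QE: "Q o\<^sub>L E = Q" by (rule blinfun_eqI) (simp add: Q_def c_def EE)
    define F where "F = E - Q"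
    have FE: "F o\<^sub>L E = F" using is_projectionD(2)[OF E(2)] by (simp add: F_def op_distribs QE)
    have F: "is_projection F" unfolding F_def using E(2) z(2) EQ by (intro is_projection_diff) (auto simp: Q_def)
    have "E o\<^sub>L F = F" using is_projectionD(2)[OF E(2)] by (simp add: F_def op_distribs EQ)
    note EF = compose_eqD[OF this]
    have Fy: "(\<lambda>k. F (y k) - y k) \<longlonglongrightarrow> 0"
    proof -
      have "(\<lambda>k. E (d (E (y k) - y k)) + E (d (y k))) \<longlonglongrightarrow> E (d 0) + E 0"
        by (intro tendsto_add blinfun.tendsto tendsto_const Ey dy)
      then have "(\<lambda>k. c (y k)) \<longlonglongrightarrow> 0" by (simp add: c_def blinfun.bilinear_simps)
      then have "(\<lambda>k. c (z (c (y k)))) \<longlonglongrightarrow> c (z 0)" by (intro blinfun.tendsto tendsto_const)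
      then have "(\<lambda>k. (E (y k) - y k) - Q (y k)) \<longlonglongrightarrow> 0 - 0"
        by (intro tendsto_diff Ey) (simp add: Q_def)
      then show ?thesis by (simp add: F_def blinfun.bilinear_simps algebra_simps)
    qed
    have "F o\<^sub>L d o\<^sub>L F = (c - (Q o\<^sub>L c)) o\<^sub>L F"
      by (rule blinfun_eqI)
        (use compose_eqD[OF FE] EF in \<open>simp add: F_def c_def blinfun.bilinear_simps EE compose_eqD[OF QE]\<close>)
    then have "norm (F o\<^sub>L d o\<^sub>L F) \<le> norm (c - (Q o\<^sub>L c)) * norm F" by (simp add: norm_blinfun_compose)
    also have "\<dots> \<le> 1 / real (Suc n) * 1"
    proof (rule mult_mono)
      show "norm F \<le> 1" using projection_norm_le[OF F] by (intro norm_blinfun_bound) auto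
    qed (use z(3) in \<open>auto simp: Q_def\<close>)
    finally have "good (Suc n) F"
      using F Fy E z(1) c(1) by (simp add: good_def) (auto simp: F_def Q_def intro!: mems)
    then show ?thesis using FE by blast
  qed
  ultimately obtain E where E: "\<And>n. good n (E n)" "\<And>n. E (Suc n) o\<^sub>L E n = E (Suc n)"
    using dependent_nat_choice[of good "\<lambda>n E F. F o\<^sub>L E = F"] by metis
  have "(\<lambda>n. norm (E n o\<^sub>L d o\<^sub>L E n)) \<longlonglongrightarrow> 0"
  proof (rule Lim_null_comparison[OF _ lim_1_over_n], rule eventually_sequentiallyI[of 1])
    show "norm (norm (E n o\<^sub>L d o\<^sub>L E n)) \<le> 1 / real n" if "1 \<le> n" for n
      using E(1)[of n] that by (simp add: good_def)
  qed
  then show ?thesis using that[of E] E by (simp add: good_def)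
qed

end

lemma orthogonal_projection:
  fixes M :: "'h::{real_inner,complete_space} set"
  assumes M: "subspace M" and cl: "closed M"
  obtains g :: "'h \<Rightarrow>\<^sub>L 'h" where "is_projection g" "\<And>x. g x = x \<longleftrightarrow> x \<in> M"
proof -
  have "\<exists>p\<in>M. \<forall>m\<in>M. inner (x - p) m = 0" for x
    using hilbert_projection[OF M cl, of x] by metis
  then obtain f where f: "\<And>x. f x \<in> M" "\<And>x m. m \<in> M \<Longrightarrow> inner (x - f x) m = 0" by metis
  have uniq: "p = f x" if "p \<in> M" "\<And>m. m \<in> M \<Longrightarrow> inner (x - p) m = 0" for p x
  proof -
    have "p - f x \<in> M" using that f(1) M by (intro subspace_diff)
    with that f(2) have "inner (x - f x) (p - f x) = 0" "inner (x - p) (p - f x) = 0" by auto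
    then have "inner (p - f x) (p - f x) = 0" by (simp add: inner_diff_left)
    then show ?thesis by simp
  qed
  have fM: "f x = x" if "x \<in> M" for x using uniq[of x x] that by simp
  have lin: "bounded_linear f"
  proof (rule bounded_linear_intro)
    show "f (x + y) = f x + f y" for x y
      by (rule uniq[symmetric])
        (use f M in \<open>auto simp: subspace_add add_diff_add inner_add_left\<close>)
    show "f (r *\<^sub>R x) = r *\<^sub>R f x" for r x
      by (rule uniq[symmetric])
        (use f M in \<open>auto simp: subspace_scale simp flip: scaleR_right_diff_distrib\<close>)
    show "norm (f x) \<le> norm x * 1" for x
    proof -
      have "(norm x)\<^sup>2 = (norm (f x))\<^sup>2 + (norm (x - f x))\<^sup>2"
        using f(2)[OF f(1), of x x]
        by (simp add: power2_norm_eq_inner inner_diff inner_commute)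
      then have "(norm (f x))\<^sup>2 \<le> (norm x)\<^sup>2" by simp
      then have "norm (f x) \<le> norm x" by (rule power2_le_imp_le) simp
      then show ?thesis by simp
    qed
  qed
  have ap: "blinfun_apply (Blinfun f) = f" by (rule bounded_linear_Blinfun_apply[OF lin])
  have "inner (f x) y = inner x (f y)" for x y
    using f(2)[OF f(1), of x y] f(2)[OF f(1), of y x]
    unfolding inner_diff_left by (simp add: inner_commute)
  then have "is_projection (Blinfun f)"
    by (auto simp: is_projection_def symmetric_op_def ap fM f(1) intro!: blinfun_eqI)
  moreover have "f x = x \<longleftrightarrow> x \<in> M" for x using f(1)[of x] fM[of x] by auto
  ultimately show ?thesis using that[of "Blinfun f"] by (simp add: ap)
qed

lemma common_fixed_points_projection:
  fixes L :: "('h::{real_inner,complete_space} \<Rightarrow>\<^sub>L 'h) set"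
  obtains g :: "'h \<Rightarrow>\<^sub>L 'h" where "is_projection g" "\<And>x. g x = x \<longleftrightarrow> (\<forall>Q\<in>L. Q x = x)"
proof -
  define M where "M = {x. \<forall>Q\<in>L. Q x = x}"
  have "subspace M" by (auto simp: M_def subspace_def blinfun.bilinear_simps)
  moreover have "closed M"
  proof -
    have "M = (\<Inter>Q\<in>L. {x. blinfun_apply Q x = x})" by (auto simp: M_def)
    then show ?thesis by (auto intro!: closed_Collect_eq continuous_intros)
  qed
  ultimately obtain g :: "'h \<Rightarrow>\<^sub>L 'h" where "is_projection g" "\<And>x. g x = x \<longleftrightarrow> x \<in> M"
    using orthogonal_projection by blast
  then show ?thesis using that by (simp add: M_def)
qed

section \<open>Adjoining the identity\<close>

context op_algebra
begin

text \<open>If \<open>\<parallel>1 - a\<parallel> < 1\<close> then the elements \<open>1 - (1 - a)\<^sup>k\<close> of the algebra converge to \<open>1\<close>.\<close>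

lemma id_mem_of_near_id:
  assumes a: "a \<in> A" and na: "norm (id_blinfun - a) < 1"
  shows "id_blinfun \<in> A"
proof -
  define X where "X = rec_nat 0 (\<lambda>_ x. a + x - (a o\<^sub>L x))"
  have X0: "X 0 = 0" and XS: "X (Suc k) = a + X k - (a o\<^sub>L X k)" for k by (auto simp: X_def)
  have mem: "X k \<in> A" for k by (induction k) (auto simp: X0 XS intro!: mems a)
  let ?r = "norm (id_blinfun - a)"
  have "norm (X k - id_blinfun) \<le> ?r ^ k" for k
  proof (induction k)
    case (Suc k)
    have "X (Suc k) - id_blinfun = (id_blinfun - a) o\<^sub>L (X k - id_blinfun)"
      by (simp add: XS op_distribs)
    then have "norm (X (Suc k) - id_blinfun) \<le> ?r * norm (X k - id_blinfun)"
      by (simp add: norm_blinfun_compose)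
    also have "\<dots> \<le> ?r * ?r ^ k" by (intro mult_left_mono Suc) simp
    finally show ?case by simp
  qed (simp add: X0 norm_blinfun_id_le)
  then have "(\<lambda>k. X k - id_blinfun) \<longlonglongrightarrow> 0"
    using na by (intro Lim_null_comparison[OF _ LIMSEQ_power_zero[of ?r]]) auto
  then have "X \<longlonglongrightarrow> id_blinfun" by (simp add: LIM_zero_iff)
  then show ?thesis by (rule limit_mem[OF mem])
qed

definition adjoin_id :: "('h \<Rightarrow>\<^sub>L 'h) set" where
  "adjoin_id = {a + r *\<^sub>R id_blinfun | a r. a \<in> A}"

lemma adjoin_idI: "a \<in> A \<Longrightarrow> a + r *\<^sub>R id_blinfun \<in> adjoin_id"
  by (auto simp: adjoin_id_def)

lemma adjoin_id_superset: "a \<in> A \<Longrightarrow> a \<in> adjoin_id"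
  using adjoin_idI[of a 0] by simp

lemma id_mem_adjoin_id: "id_blinfun \<in> adjoin_id"
  using adjoin_idI[OF zero_mem, of 1] by simp

lemma abs_le_norm_adjoin_id:
  assumes id: "id_blinfun \<notin> A" and a: "a \<in> A"
  shows "\<bar>r\<bar> \<le> norm (a + r *\<^sub>R id_blinfun)"
proof (rule ccontr)
  assume less: "\<not> ?thesis"
  then have r: "r \<noteq> 0" by auto
  have "id_blinfun - (- (1 / r)) *\<^sub>R a = (1 / r) *\<^sub>R (a + r *\<^sub>R id_blinfun)"
    using r by (simp add: scaleR_right_distrib)
  then have "norm (id_blinfun - (- (1 / r)) *\<^sub>R a) < 1"
    using less r by (simp add: divide_less_eq)
  then show False using id_mem_of_near_id[OF scaleR_mem[OF a]] id by blast
qed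

lemma op_algebra_adjoin_id:
  assumes id: "id_blinfun \<notin> A"
  shows "op_algebra adjoin_id"
proof
  show "0 \<in> adjoin_id" by (intro adjoin_id_superset zero_mem)
next
  fix x y assume "x \<in> adjoin_id" "y \<in> adjoin_id"
  then obtain a r b t where ab: "a \<in> A" "b \<in> A"
      and xy: "x = a + r *\<^sub>R id_blinfun" "y = b + t *\<^sub>R id_blinfun"
    by (auto simp: adjoin_id_def)
  have "x + y = (a + b) + (r + t) *\<^sub>R id_blinfun" by (simp add: xy scaleR_left_distrib)
  then show "x + y \<in> adjoin_id" using ab by (auto intro!: adjoin_idI mems)
  have "x o\<^sub>L y = ((a o\<^sub>L b) + t *\<^sub>R a + r *\<^sub>R b) + (r * t) *\<^sub>R id_blinfun"
    by (simp add: xy op_distribs scaleR_right_distrib mult.commute)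
  then show "x o\<^sub>L y \<in> adjoin_id" using ab by (auto intro!: adjoin_idI mems)
next
  fix x and t :: real assume "x \<in> adjoin_id"
  then obtain a r where a: "a \<in> A" and x: "x = a + r *\<^sub>R id_blinfun" by (auto simp: adjoin_id_def)
  have "t *\<^sub>R x = t *\<^sub>R a + (t * r) *\<^sub>R id_blinfun" by (simp add: x scaleR_right_distrib)
  then show "t *\<^sub>R x \<in> adjoin_id" using a by (auto intro!: adjoin_idI mems)
next
  show "closed adjoin_id"
  proof (rule closed_sequential_limits[THEN iffD2], intro allI impI, elim conjE)
    fix X L assume mem: "\<forall>n. X n \<in> adjoin_id" and lim: "X \<longlonglongrightarrow> L"
    then have "\<forall>n. \<exists>a r. a \<in> A \<and> X n = a + r *\<^sub>R id_blinfun"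
      unfolding adjoin_id_def by blast
    then obtain a r where a: "\<And>n. a n \<in> A" and X: "\<And>n. X n = a n + r n *\<^sub>R id_blinfun" by metis
    have le: "\<bar>r m - r n\<bar> \<le> norm (X m - X n)" for m n
    proof -
      have "X m - X n = (a m - a n) + (r m - r n) *\<^sub>R id_blinfun"
        by (simp add: X scaleR_left_diff_distrib)
      then show ?thesis using abs_le_norm_adjoin_id[OF id, of "a m - a n" "r m - r n"] a by (simp add: mems)
    qed
    have "Cauchy r"
    proof (rule metric_CauchyI)
      fix e :: real assume "0 < e"
      then obtain N where "\<And>m n. m \<ge> N \<Longrightarrow> n \<ge> N \<Longrightarrow> dist (X m) (X n) < e"
        using LIMSEQ_imp_Cauchy[OF lim] metric_CauchyD by blast
      then show "\<exists>N. \<forall>m\<ge>N. \<forall>n\<ge>N. dist (r m) (r n) < e"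
        using le by (metis dist_norm dist_real_def order_le_less_trans)
    qed
    then obtain c where c: "r \<longlonglongrightarrow> c" using Cauchy_convergent convergent_def by blast
    have "(\<lambda>n. X n - r n *\<^sub>R id_blinfun) \<longlonglongrightarrow> L - c *\<^sub>R id_blinfun"
      by (intro tendsto_intros lim c)
    then have "a \<longlonglongrightarrow> L - c *\<^sub>R id_blinfun" by (simp add: X)
    then have "L - c *\<^sub>R id_blinfun \<in> A" by (rule limit_mem[OF a])
    from adjoin_idI[OF this, of c] show "L \<in> adjoin_id" by simp
  qed
qed

lemma projection_mem_of_near:
  assumes id: "id_blinfun \<notin> A" and E: "E \<in> adjoin_id" "E o\<^sub>L E = E" and a: "a \<in> A"
    and n: "norm (E o\<^sub>L (id_blinfun - a) o\<^sub>L E) < 1"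
  shows "E \<in> A"
proof -
  obtain x r where x: "x \<in> A" and Ex: "E = x + r *\<^sub>R id_blinfun" using E(1) by (auto simp: adjoin_id_def)
  have "(r * r - r) *\<^sub>R id_blinfun = x - (x o\<^sub>L x) - (2 * r) *\<^sub>R x"
    using E(2) by (simp add: Ex op_distribs algebra_simps scaleR_2 flip: scaleR_scaleR)
  then have mem: "(r * r - r) *\<^sub>R id_blinfun \<in> A" using x by (auto intro: mems)
  have "r * r - r = 0"
  proof (rule ccontr)
    assume "r * r - r \<noteq> 0"
    then show False using scaleR_mem[OF mem, of "inverse (r * r - r)"] id by simp
  qed
  then have "r * (r - 1) = 0" by (simp add: algebra_simps)
  moreover have "r \<noteq> 1"
  proof
    assume r: "r = 1"
    have "E o\<^sub>L (id_blinfun - a) o\<^sub>L E = id_blinfun - ((E o\<^sub>L (a o\<^sub>L E)) - x)"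
      using E(2) by (simp add: op_distribs op_assoc) (simp add: Ex r)
    moreover have "(E o\<^sub>L (a o\<^sub>L E)) - x \<in> A"
    proof -
      have aE: "a o\<^sub>L E \<in> A" using x a by (simp add: Ex op_distribs mems)
      have "E o\<^sub>L (a o\<^sub>L E) = (x o\<^sub>L (a o\<^sub>L E)) + r *\<^sub>R (a o\<^sub>L E)" by (subst Ex) (simp add: op_distribs)
      then show ?thesis using x aE by (simp add: mems)
    qed
    ultimately show False using id_mem_of_near_id id n by metis
  qed
  ultimately show ?thesis using x by (simp add: Ex)
qed

end

section \<open>Homomorphisms\<close>

locale real_op_hom = op_algebra +
  fixes \<pi> :: "('a \<Rightarrow>\<^sub>L 'a) \<Rightarrow> ('b::{real_inner,complete_space} \<Rightarrow>\<^sub>L 'b)"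
  assumes hom_add: "a \<in> A \<Longrightarrow> b \<in> A \<Longrightarrow> \<pi> (a + b) = \<pi> a + \<pi> b"
    and hom_scaleR: "a \<in> A \<Longrightarrow> \<pi> (r *\<^sub>R a) = r *\<^sub>R \<pi> a"
    and hom_compose: "a \<in> A \<Longrightarrow> b \<in> A \<Longrightarrow> \<pi> (a o\<^sub>L b) = \<pi> a o\<^sub>L \<pi> b"
    and hom_symmetric: "a \<in> A \<Longrightarrow> symmetric_op a \<Longrightarrow> symmetric_op (\<pi> a)"
begin

lemma hom_diff: "a \<in> A \<Longrightarrow> b \<in> A \<Longrightarrow> \<pi> (a - b) = \<pi> a - \<pi> b"
  using hom_add[of a "(-1) *\<^sub>R b"] hom_scaleR[of b "-1"] scaleR_mem[of b "-1"] by simp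

lemma hom_left_quasi_inverse:
  assumes "v \<in> A" "norm v < 1"
  obtains L where "\<And>x. L (x - \<pi> v x) = x" "bounded_linear L"
proof -
  from quasi_inverse[OF assms] obtain s where s: "s \<in> A" "s = v + (s o\<^sub>L v)" by metis
  have "\<pi> s = \<pi> (v + (s o\<^sub>L v))" using s(2) by simp
  then have \<pi>s: "\<pi> s = \<pi> v + (\<pi> s o\<^sub>L \<pi> v)"
    using assms s(1) by (simp add: hom_add hom_compose compose_mem)
  have "(id_blinfun + \<pi> s) (x - \<pi> v x) = x" for x
  proof -
    have "\<pi> s x = \<pi> v x + \<pi> s (\<pi> v x)" by (subst \<pi>s) (simp add: blinfun.bilinear_simps)
    then show ?thesis by (simp add: blinfun.bilinear_simps)
  qed
  then show ?thesis using that blinfun.bounded_linear_right by blast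
qed

lemma hom_form_le:
  assumes a: "a \<in> A" "symmetric_op a"
  shows "inner (\<pi> a x) x \<le> norm a * (norm x)\<^sup>2"
proof (rule form_le_of_bounded_below)
  show "symmetric_op (\<pi> a)" by (rule hom_symmetric[OF a])
  fix \<mu> assume \<mu>: "norm a < \<mu>"
  then have pos: "0 < \<mu>" using norm_ge_zero order_le_less_trans by blast
  have "(1 / \<mu>) *\<^sub>R a \<in> A" "norm ((1 / \<mu>) *\<^sub>R a) < 1" using a \<mu> pos by (auto intro: mems)
  then obtain L where L: "\<And>x. L (x - \<pi> ((1 / \<mu>) *\<^sub>R a) x) = x" "bounded_linear L"
    using hom_left_quasi_inverse by metis
  obtain K where K: "\<And>y. norm (L y) \<le> norm y * K" using bounded_linear.bounded[OF L(2)] by blast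
  interpret L: bounded_linear L by fact
  show "\<exists>\<delta>>0. \<forall>x. \<delta> * norm x \<le> norm (\<pi> a x - \<mu> *\<^sub>R x)"
  proof (rule bounded_below_of_left_inverse[where L = "\<lambda>y. (- 1 / \<mu>) *\<^sub>R L y" and K = "K / \<mu>"])
    fix x
    have "(- 1 / \<mu>) *\<^sub>R (\<pi> a x - \<mu> *\<^sub>R x) = x - \<pi> ((1 / \<mu>) *\<^sub>R a) x"
      using pos by (simp add: hom_scaleR[OF a(1)] blinfun.bilinear_simps scaleR_right_diff_distrib)
    then show "(- 1 / \<mu>) *\<^sub>R L (\<pi> a x - \<mu> *\<^sub>R x) = x"
      using L(1)[of x] by (simp flip: L.scaleR)
  next
    fix y show "norm ((- 1 / \<mu>) *\<^sub>R L y) \<le> K / \<mu> * norm y"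
      using pos divide_right_mono[OF K[of y], of \<mu>] by (simp add: mult.commute)
  qed
qed

end

section \<open>Hilbert spaces over the scalar field\<close>

lemma to_complex_of_real: "to_complex (of_real r :: 'f::real_or_complex_field) = of_real r"
  by (simp add: of_real_def to_complex_scaleR to_complex_one)

lemma to_complex_diff: "to_complex (x - y) = to_complex x - to_complex y"
  using to_complex_add[of "x - y" y] by simp

lemma to_complex_zero: "to_complex 0 = 0"
  using to_complex_diff[of 0 0] by simp

lemma to_complex_eq_iff: "to_complex x = to_complex y \<longleftrightarrow> x = y"
proof
  assume eq: "to_complex x = to_complex y"
  show "x = y"
  proof (rule ccontr)
    assume "x \<noteq> y"
    then have "(x - y) * inverse (x - y) = 1" by simp
    then have "to_complex (x - y) * to_complex (inverse (x - y)) = 1"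
      by (metis to_complex_mult to_complex_one)
    then show False using eq by (simp add: to_complex_diff)
  qed
qed simp

lemma to_complex_inverse: "c \<noteq> 0 \<Longrightarrow> to_complex (inverse c) = inverse (to_complex c)"
  by (metis inverse_unique right_inverse to_complex_mult to_complex_one)

lemma to_complex_cnj_exists:
  fixes c :: "'f::real_or_complex_field"
  obtains c' :: 'f where "to_complex c' = cnj (to_complex c)"
proof -
  have "cnj (to_complex c) \<in> range (to_complex :: 'f \<Rightarrow> complex)"
    using range_to_complex[where 'a = 'f]
    by (metis Reals_cnj_iff UNIV_I rangeI)
  then show ?thesis using that by (metis imageE)
qed

context hilbert_space_over
begin

lemma to_complex_ip_self: "to_complex (ip x x) = complex_of_real ((norm x)\<^sup>2)"
  by (simp only: ip_self to_complex_of_real)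

lemma inner_eq_Re_ip: "inner x y = Re (to_complex (ip x y))"
proof -
  have "complex_of_real ((norm (x + y))\<^sup>2) = to_complex (ip (x + y) (x + y))"
    by (rule to_complex_ip_self[symmetric])
  also have "\<dots> = to_complex (ip x (x + y)) + to_complex (ip y (x + y))"
    by (simp add: ip_add_left to_complex_add)
  also have "\<dots> = cnj (to_complex (ip (x + y) x)) + cnj (to_complex (ip (x + y) y))"
    by (metis ip_commute)
  also have "\<dots> = of_real ((norm x)\<^sup>2) + of_real ((norm y)\<^sup>2)
      + (cnj (to_complex (ip x y)) + to_complex (ip x y))"
    using ip_commute[of x y]
    by (simp add: ip_add_left to_complex_add to_complex_ip_self)
  finally have "(norm (x + y))\<^sup>2 = (norm x)\<^sup>2 + (norm y)\<^sup>2 + 2 * Re (to_complex (ip x y))"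
    by (simp add: complex_eq_iff)
  then show ?thesis by (simp add: power2_norm_eq_inner inner_add inner_commute)
qed

lemma ip_smul_right: "to_complex (ip x (smul c y)) = cnj (to_complex c) * to_complex (ip x y)"
proof -
  have "to_complex (ip x (smul c y)) = cnj (to_complex (ip (smul c y) x))" by (rule ip_commute)
  then show ?thesis by (simp add: ip_smul_left to_complex_mult ip_commute[of y x])
qed

lemma norm_smul: "norm (smul c x) = cmod (to_complex c) * norm x"
proof -
  have "complex_of_real ((norm (smul c x))\<^sup>2) = to_complex (ip (smul c x) (smul c x))"
    by (rule to_complex_ip_self[symmetric])
  also have "\<dots> = (to_complex c * cnj (to_complex c)) * of_real ((norm x)\<^sup>2)"
    unfolding ip_smul_right ip_smul_left to_complex_mult to_complex_ip_self by simp
  also have "\<dots> = complex_of_real ((cmod (to_complex c) * norm x)\<^sup>2)"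
    by (simp only: complex_norm_square[symmetric] power_mult_distrib of_real_mult of_real_power)
  finally have "(norm (smul c x))\<^sup>2 = (cmod (to_complex c) * norm x)\<^sup>2"
    by (simp only: of_real_eq_iff)
  then show ?thesis by (simp add: power2_eq_iff_nonneg)
qed

lemma inner_smul:
  assumes "to_complex c' = cnj (to_complex c)"
  shows "inner (smul c x) y = inner x (smul c' y)"
  using assms by (simp add: inner_eq_Re_ip ip_smul_left ip_smul_right to_complex_mult)

lemma smul_scaleR: "smul c (r *\<^sub>R x) = r *\<^sub>R smul c x"
  by (metis mult.commute scale_scale smul_of_real)

lemma bounded_linear_smul: "bounded_linear (smul c)"
proof (rule bounded_linear_intro)
  show "smul c (x + y) = smul c x + smul c y" for x y by (rule scale_right_distrib)
  show "smul c (r *\<^sub>R x) = r *\<^sub>R smul c x" for r x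
    by (rule smul_scaleR)
  show "norm (smul c x) \<le> norm x * cmod (to_complex c)" for x by (simp add: norm_smul)
qed

lemma smul_op_apply: "smul_op smul c T x = smul c (T x)"
proof -
  have "bounded_linear (\<lambda>x. smul c (T x))"
    by (rule bounded_linear_compose[OF bounded_linear_smul]) (rule blinfun.bounded_linear_right)
  then show ?thesis by (simp add: smul_op_def bounded_linear_Blinfun_apply)
qed

lemma smul_op_of_real: "smul_op smul (of_real r) T = r *\<^sub>R T"
  by (rule blinfun_eqI) (simp add: smul_op_apply smul_of_real blinfun.scaleR_left)

lemma bounded_opsD: "T \<in> bounded_ops smul \<Longrightarrow> T (smul c x) = smul c (T x)"
  by (simp add: bounded_ops_def)

lemma ip_eq_of_inner_eq:
  assumes T: "T \<in> bounded_ops smul" and eq: "\<And>x. inner (T x) y = inner x z"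
  shows "ip (T x) y = ip x z"
proof -
  have Re: "Re (to_complex (ip (T x) y)) = Re (to_complex (ip x z))" for x
    using eq[of x] by (simp add: inner_eq_Re_ip)
  have "Im (to_complex (ip (T x) y)) = Im (to_complex (ip x z))"
  proof (cases "\<i> \<in> range (to_complex :: 'f \<Rightarrow> complex)")
    case True
    then obtain c :: 'f where c: "to_complex c = \<i>" by (metis imageE)
    show ?thesis using Re[of "smul c x"]
      by (simp add: bounded_opsD[OF T] ip_smul_left to_complex_mult c)
  next
    case False
    then have "range (to_complex :: 'f \<Rightarrow> complex) = \<real>" using range_to_complex[where 'a = 'f] by auto
    then have "to_complex (ip (T x) y) \<in> \<real>" "to_complex (ip x z) \<in> \<real>" by auto
    then show ?thesis by (simp add: complex_is_Real_iff)
  qed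
  with Re[of x] have "to_complex (ip (T x) y) = to_complex (ip x z)" by (rule complex_eqI)
  then show ?thesis by (simp only: to_complex_eq_iff)
qed

lemma adj_eqI:
  fixes U :: "'h \<Rightarrow>\<^sub>L 'h"
  assumes T: "T \<in> bounded_ops smul" and U: "\<And>x y. inner (T x) y = inner x (U y)"
  shows "adj ip T = U"
  unfolding adj_def
proof (rule the_equality)
  show "\<forall>x y. ip (T x) y = ip x (U y)" using ip_eq_of_inner_eq[OF T U] by blast
  fix S :: "'h \<Rightarrow>\<^sub>L 'h" assume S: "\<forall>x y. ip (T x) y = ip x (S y)"
  have "inner (S x) y = inner (U x) y" for x y
  proof -
    have "inner y (S x) = inner (T y) x" using S by (simp add: inner_eq_Re_ip)
    then show ?thesis using U[of y x] by (simp add: inner_commute)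
  qed
  then show "S = U" by (rule symmetric_op_unique)
qed

lemma inner_adj:
  assumes T: "T \<in> bounded_ops smul"
  shows "inner (T x) y = inner x (adj ip T y)"
proof -
  obtain U :: "'h \<Rightarrow>\<^sub>L 'h" where U: "\<And>x y. inner (T x) y = inner x (U y)"
    by (rule hilbert_adjoint_exists[of T]) blast
  then show ?thesis using adj_eqI[OF T U] by simp
qed

lemma adj_eq_self_iff: "T \<in> bounded_ops smul \<Longrightarrow> adj ip T = T \<longleftrightarrow> symmetric_op T"
  using adj_eqI[of T T] inner_adj[of T] by (auto simp: symmetric_op_def)

lemma op_algebra_bounded_ops: "op_algebra (bounded_ops smul)"
proof
  show "closed (bounded_ops smul)"
  proof (rule closed_sequential_limits[THEN iffD2], intro allI impI, elim conjE)
    fix X L assume mem: "\<forall>n. X n \<in> bounded_ops smul" and lim: "X \<longlonglongrightarrow> L"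
    have "L (smul c x) = smul c (L x)" for c x
    proof (rule LIMSEQ_unique)
      show "(\<lambda>n. X n (smul c x)) \<longlonglongrightarrow> L (smul c x)" by (intro blinfun.tendsto lim tendsto_const)
      have "(\<lambda>n. smul c (X n x)) \<longlonglongrightarrow> smul c (L x)"
        by (intro bounded_linear.tendsto[OF bounded_linear_smul] blinfun.tendsto lim tendsto_const)
      then show "(\<lambda>n. X n (smul c x)) \<longlonglongrightarrow> smul c (L x)" using mem by (simp add: bounded_opsD)
    qed
    then show "L \<in> bounded_ops smul" by (simp add: bounded_ops_def)
  qed
qed (auto simp: bounded_ops_def blinfun.bilinear_simps scale_right_distrib smul_scaleR)

lemma id_mem_bounded_ops: "id_blinfun \<in> bounded_ops smul"
  by (simp add: bounded_ops_def)

lemma smul_op_mem_bounded_ops: "T \<in> bounded_ops smul \<Longrightarrow> smul_op smul c T \<in> bounded_ops smul"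
  by (simp add: bounded_ops_def smul_op_apply scale_scale mult.commute)

lemma mem_projections_iff:
  "A \<subseteq> bounded_ops smul \<Longrightarrow> P \<in> projections ip A \<longleftrightarrow> P \<in> A \<and> is_projection P"
  unfolding projections_def is_projection_def using adj_eq_self_iff by blast

lemma proj_le_iff:
  assumes "is_projection P" "is_projection Q"
  shows "proj_le P Q \<longleftrightarrow> (\<forall>x. P x = x \<longrightarrow> Q x = x)"
proof
  assume "proj_le P Q"
  then have PQ: "P o\<^sub>L Q = P" by (simp add: proj_le_def)
  then have "Q o\<^sub>L P = P" using symmetric_op_compose_commute[of P Q] assms is_projectionD(1) by metis
  then show "\<forall>x. P x = x \<longrightarrow> Q x = x" by (metis compose_eqD)
next
  assume "\<forall>x. P x = x \<longrightarrow> Q x = x"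
  then have "Q o\<^sub>L P = P" using is_projectionD(3)[OF assms(1)] by (intro blinfun_eqI) simp
  then show "proj_le P Q" unfolding proj_le_def
    using symmetric_op_compose_commute[of Q P] assms is_projectionD(1) by metis
qed

lemma proj_meet_projection:
  assumes L: "\<And>Q. Q \<in> L \<Longrightarrow> Q \<in> bounded_ops smul" "\<And>Q. Q \<in> L \<Longrightarrow> is_projection Q"
  shows "proj_meet smul ip L \<in> bounded_ops smul" "is_projection (proj_meet smul ip L)"
    "proj_meet smul ip L x = x \<longleftrightarrow> (\<forall>Q\<in>L. Q x = x)"
proof -
  obtain g :: "'h \<Rightarrow>\<^sub>L 'h" where g: "is_projection g" "\<And>x. g x = x \<longleftrightarrow> (\<forall>Q\<in>L. Q x = x)"
    using common_fixed_points_projection[of L] by blast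
  have "g (smul c x) = smul c (g x)" for c x
  proof -
    obtain c' :: 'f where c': "to_complex c' = cnj (to_complex c)" using to_complex_cnj_exists by blast
    have smulM: "g (smul a u) = smul a u" if "g u = u" for a u
      using that bounded_opsD[OF L(1)] by (auto simp: g(2))
    have gg: "g (g v) = g v" for v by (rule is_projectionD(3)[OF g(1)])
    define u where "u = g (smul c x) - smul c (g x)"
    have gu: "g u = u" by (simp add: u_def blinfun.bilinear_simps gg smulM)
    have "inner (g (smul c x)) u = inner (smul c x) u"
      using gu is_projectionD(4)[OF g(1)] by simp
    moreover have "inner (smul c (g x)) u = inner (smul c x) u"
      using smulM[OF gu] is_projectionD(4)[OF g(1)] by (simp add: inner_smul[OF c'])
    ultimately have "inner u u = 0" by (subst (1) u_def) (simp add: inner_diff_left)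
    then show ?thesis by (simp add: u_def)
  qed
  then have gB: "g \<in> bounded_ops smul" by (simp add: bounded_ops_def)
  note proj = mem_projections_iff[OF order_refl]
  have "proj_meet smul ip L = g"
    unfolding proj_meet_def
  proof (rule the_equality)
    show glb: "is_glb proj_le (projections ip (bounded_ops smul)) L g"
      using gB g L by (auto simp: is_glb_def proj proj_le_iff)
    fix h assume h: "is_glb proj_le (projections ip (bounded_ops smul)) L h"
    then have hp: "is_projection h" unfolding is_glb_def proj by blast
    have "proj_le g h" "proj_le h g" using h glb unfolding is_glb_def by blast+
    then have "g o\<^sub>L h = g" "h o\<^sub>L g = h" by (auto simp: proj_le_def)
    then show "h = g"
      using symmetric_op_compose_commute[of g h] is_projectionD(1) g(1) hp by metis
  qed
  then show "proj_meet smul ip L \<in> bounded_ops smul" "is_projection (proj_meet smul ip L)"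
    "proj_meet smul ip L x = x \<longleftrightarrow> (\<forall>Q\<in>L. Q x = x)"
    using gB g by auto
qed

lemma op_algebra_of_cstar_algebra_on:
  assumes "cstar_algebra_on smul ip A"
  shows "op_algebra A"
proof
  show "r *\<^sub>R a \<in> A" if "a \<in> A" for a r
    using assms that unfolding cstar_algebra_on_def smul_op_of_real[symmetric] by blast
qed (use assms in \<open>auto simp: cstar_algebra_on_def\<close>)

lemma real_rank_zero_unitization:
  assumes A: "cstar_algebra_on smul ip A" and rr: "real_rank_zero smul ip A"
  obtains A1 e where "unital_real_rank_zero A1 e" "A \<subseteq> A1"
    "\<And>E a. E \<in> A1 \<Longrightarrow> is_projection E \<Longrightarrow> a \<in> A \<Longrightarrow> norm (E o\<^sub>L (e - a) o\<^sub>L E) < 1 \<Longrightarrow> E \<in> A"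
proof -
  interpret op_algebra A by (rule op_algebra_of_cstar_algebra_on[OF A])
  have AB: "A \<subseteq> bounded_ops smul" and adjA: "\<And>a. a \<in> A \<Longrightarrow> adj ip a \<in> A"
    and smulA: "\<And>c a. a \<in> A \<Longrightarrow> smul_op smul c a \<in> A"
    using A by (auto simp: cstar_algebra_on_def)
  define U where "U = unitization smul A"
  obtain e where e: "is_unit_of U e"
    and dense: "{a \<in> U. adj ip a = a} \<subseteq>
        closure {a \<in> U. adj ip a = a \<and> (\<exists>b \<in> U. a o\<^sub>L b = e \<and> b o\<^sub>L a = e)}"
    using rr unfolding real_rank_zero_def U_def by blast
  have UB: "U \<subseteq> bounded_ops smul"
    using AB op_algebra.add_mem[OF op_algebra_bounded_ops]
      smul_op_mem_bounded_ops[OF id_mem_bounded_ops]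
    by (auto simp: U_def unitization_def)
  have approx: "\<exists>b\<in>U. symmetric_op b \<and> norm (a - b) < \<epsilon> \<and> (\<exists>\<delta>>0. \<forall>x. \<delta> * norm (e x) \<le> norm (b x))"
    if a: "a \<in> U" "symmetric_op a" and \<epsilon>: "0 < \<epsilon>" for a \<epsilon>
  proof -
    have "a \<in> closure {a \<in> U. adj ip a = a \<and> (\<exists>b \<in> U. a o\<^sub>L b = e \<and> b o\<^sub>L a = e)}"
      using dense a UB adj_eq_self_iff by blast
    with \<epsilon> obtain b b' where b: "b \<in> U" "adj ip b = b" "b' o\<^sub>L b = e" "dist b a < \<epsilon>"
      unfolding closure_approachable by blast
    have "1 / (norm b' + 1) * norm (e x) \<le> norm (b x)" for x
    proof -
      have "norm (e x) \<le> norm b' * norm (b x)"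
        using norm_blinfun[of b' "b x"] compose_eqD[OF b(3)] by simp
      also have "\<dots> \<le> (norm b' + 1) * norm (b x)" by (intro mult_right_mono) auto
      finally show ?thesis by (simp add: pos_divide_le_eq add_nonneg_pos mult.commute)
    qed
    moreover have "0 < 1 / (norm b' + 1)" by (simp add: add_nonneg_pos)
    moreover have "symmetric_op b" using b(1,2) UB adj_eq_self_iff by blast
    moreover have "norm (a - b) < \<epsilon>" using b(4) by (simp add: dist_norm norm_minus_commute)
    ultimately show ?thesis using b(1) by blast
  qed
  show ?thesis
  proof (cases "\<exists>e. is_unit_of A e")
    case True
    then have UA: "U = A" by (simp add: U_def unitization_def)
    have eA: "e \<in> A" and eu: "\<And>a. a \<in> A \<Longrightarrow> e o\<^sub>L a = a" "\<And>a. a \<in> A \<Longrightarrow> a o\<^sub>L e = a"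
      using e by (auto simp: UA is_unit_of_def)
    have "symmetric_op e"
      unfolding symmetric_op_def
    proof (intro allI)
      fix x y
      have adj: "inner (e v) w = inner v (adj ip e w)" for v w using eA AB inner_adj by blast
      have ea: "e (adj ip e v) = adj ip e v" for v using compose_eqD[OF eu(1)[OF adjA[OF eA]]] by simp
      have "inner (adj ip e v) (adj ip e w) = inner (adj ip e v) w" for v w
        using adj[of "adj ip e v" w] ea by simp
      then have "inner (adj ip e v) w = inner v (adj ip e w)" for v w
        by (metis inner_commute)
      then show "inner (e x) y = inner x (e y)"
        using adj by (metis inner_commute)
    qed
    then have "is_projection e" using eu(1)[OF eA] by (simp add: is_projection_def)
    then have "unital_real_rank_zero A e"
      using approx eA eu unfolding UA by unfold_locales auto
    then show ?thesis using that by blast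
  next
    case False
    then have U: "U = {a + smul_op smul c id_blinfun |a c. a \<in> A}" by (simp add: U_def unitization_def)
    have idA: "id_blinfun \<notin> A" using False by (auto simp: is_unit_of_def)
    have "id_blinfun = 0 + smul_op smul 1 id_blinfun" by (rule blinfun_eqI) (simp add: smul_op_apply)
    then have "id_blinfun \<in> U" unfolding U using zero_mem by blast
    then have e_id: "e = id_blinfun" using e by (metis is_unit_of_def op_id(2))
    have sub: "adjoin_id \<subseteq> U"
      unfolding adjoin_id_def U smul_op_of_real[symmetric] by blast
    have sym: "b \<in> adjoin_id" if b: "b \<in> U" "symmetric_op b" for b
    proof -
      obtain a c where a: "a \<in> A" and bac: "b = a + smul_op smul c id_blinfun" using b(1) by (auto simp: U)
      obtain c' :: 'f where c': "to_complex c' = cnj (to_complex c)" using to_complex_cnj_exists by blast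
      have "a - adj ip a = smul_op smul (c' - c) id_blinfun"
      proof (rule symmetric_op_unique)
        fix x y
        have "inner (a x) y + inner (smul c x) y = inner x (a y) + inner x (smul c y)"
          using symmetric_opD[OF b(2), of x y] by (simp add: bac blinfun.add_left smul_op_apply inner_add)
        moreover have "inner (adj ip a x) y = inner x (a y)"
          using inner_adj[OF subsetD[OF AB a], of y x] by (simp add: inner_commute)
        moreover have "inner (smul c' x) y = inner x (smul c y)"
          by (rule inner_smul) (simp add: c')
        ultimately show "inner ((a - adj ip a) x) y = inner (smul_op smul (c' - c) id_blinfun x) y"
          by (simp add: blinfun.diff_left smul_op_apply inner_diff_left scale_left_diff_distrib)
      qed
      then have mem: "smul_op smul (c' - c) id_blinfun \<in> A"
        using diff_mem[OF a adjA[OF a]] by simp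
      have "c' - c = 0"
      proof (rule ccontr)
        assume nz: "c' - c \<noteq> 0"
        have "smul_op smul (inverse (c' - c)) (smul_op smul (c' - c) id_blinfun) = id_blinfun"
          by (rule blinfun_eqI) (use nz in \<open>simp add: smul_op_apply\<close>)
        then show False using smulA[OF mem] idA by metis
      qed
      then have "to_complex c \<in> \<real>" using c' by (simp add: Reals_cnj_iff)
      then obtain r where "to_complex c = complex_of_real r" by (auto elim: Reals_cases)
      then have "c = of_real r" by (metis to_complex_eq_iff to_complex_of_real)
      then show ?thesis using a by (simp add: bac smul_op_of_real adjoin_idI)
    qed
    have "unital_real_rank_zero adjoin_id e"
    proof -
      interpret A1: op_algebra adjoin_id by (rule op_algebra_adjoin_id[OF idA])
      show ?thesis
      proof
        show "\<exists>b\<in>adjoin_id. symmetric_op b \<and> norm (a - b) < \<epsilon> \<and>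
            (\<exists>\<delta>>0. \<forall>x. \<delta> * norm (e x) \<le> norm (b x))"
          if "a \<in> adjoin_id" "symmetric_op a" "0 < \<epsilon>" for a \<epsilon>
          using approx[OF subsetD[OF sub that(1)] that(2,3)] sym by blast
      qed (simp_all add: e_id id_mem_adjoin_id is_projection_id)
    qed
    moreover have "A \<subseteq> adjoin_id" using adjoin_id_superset by blast
    moreover have "E \<in> A" if "E \<in> adjoin_id" "is_projection E" "a \<in> A" "norm (E o\<^sub>L (e - a) o\<^sub>L E) < 1" for E a
      using projection_mem_of_near[OF idA that(1) is_projectionD(2)[OF that(2)] that(3)] that(4) e_id by simp
    ultimately show ?thesis by (rule that)
  qed
qed

end

section \<open>Products of projections\<close>

lemma op_prod_norm_le:
  "(\<And>k. k \<le> n \<Longrightarrow> is_projection (P k)) \<Longrightarrow> norm (op_prod P n x) \<le> norm x"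
proof (induction n arbitrary: x)
  case (Suc n)
  have "norm (op_prod P n (P (Suc n) x)) \<le> norm (P (Suc n) x)" using Suc by simp
  also have "\<dots> \<le> norm x" using Suc.prems by (simp add: projection_norm_le)
  finally show ?case by simp
qed (simp add: projection_norm_le)

lemma op_prod_fixed:
  fixes P :: "nat \<Rightarrow> 'h::real_normed_vector \<Rightarrow>\<^sub>L 'h"
  shows "(\<And>k. k \<le> n \<Longrightarrow> P k x = x) \<Longrightarrow> op_prod P n x = x"
  by (induction n) auto

lemma fixed_of_op_prod_norm:
  assumes "\<And>k. k \<le> n \<Longrightarrow> is_projection (P k)" "norm x \<le> norm (op_prod P n x)" "k \<le> n"
  shows "P k x = x"
  using assms
proof (induction n)
  case 0
  then show ?case by (simp add: projection_fixed_of_norm)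
next
  case (Suc n)
  have "norm (op_prod P n (P (Suc n) x)) \<le> norm (P (Suc n) x)"
    using Suc.prems(1) by (intro op_prod_norm_le) simp
  then have "norm x \<le> norm (P (Suc n) x)" using Suc.prems(2) by simp
  then have fx: "P (Suc n) x = x" using Suc.prems(1) by (intro projection_fixed_of_norm) auto
  show ?case
  proof (cases "k = Suc n")
    case False
    then show ?thesis using Suc fx by simp
  qed (simp add: fx)
qed

lemma inner_fixed_op_prod:
  "(\<And>k. k \<le> n \<Longrightarrow> is_projection (P k)) \<Longrightarrow> (\<And>k. k \<le> n \<Longrightarrow> P k z = z) \<Longrightarrow>
    inner z (op_prod P n y) = inner z y"
proof (induction n arbitrary: y)
  case 0
  then show ?case using is_projectionD(4)[of "P 0" z y] by simp
next
  case (Suc n)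
  then show ?case using is_projectionD(4)[of "P (Suc n)" z y] by simp
qed

lemma (in op_algebra) op_prod_mem: "(\<And>k. k \<le> n \<Longrightarrow> P k \<in> A) \<Longrightarrow> op_prod P n \<in> A"
  by (induction n) (auto intro: compose_mem)

lemma (in real_op_hom) hom_op_prod:
  "(\<And>k. k \<le> n \<Longrightarrow> P k \<in> A) \<Longrightarrow> \<pi> (op_prod P n) = op_prod (\<lambda>k. \<pi> (P k)) n"
  by (induction n) (auto simp: hom_compose op_prod_mem)

lemma subspace_closure:
  fixes M :: "'h::real_normed_vector set"
  assumes M: "subspace M"
  shows "subspace (closure M)"
  unfolding subspace_def
proof (intro conjI allI impI ballI)
  show "0 \<in> closure M" using subspace_0[OF M] closure_subset by blast
next
  fix x y assume "x \<in> closure M" "y \<in> closure M"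
  then obtain f h where "\<And>k. f k \<in> M" "f \<longlonglongrightarrow> x" "\<And>k. h k \<in> M" "h \<longlonglongrightarrow> y"
    unfolding closure_sequential by blast
  then have "\<And>k. f k + h k \<in> M" "(\<lambda>k. f k + h k) \<longlonglongrightarrow> x + y"
    using subspace_add[OF M] by (auto intro: tendsto_add)
  then show "x + y \<in> closure M"
    unfolding closure_sequential by (intro exI[of _ "\<lambda>k. f k + h k"]) simp
next
  fix r x assume "x \<in> closure M"
  then obtain f where "\<And>k. f k \<in> M" "f \<longlonglongrightarrow> x" unfolding closure_sequential by blast
  then have "\<And>k. r *\<^sub>R f k \<in> M" "(\<lambda>k. r *\<^sub>R f k) \<longlonglongrightarrow> r *\<^sub>R x"
    using subspace_scale[OF M] by (auto intro: tendsto_scaleR)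
  then show "r *\<^sub>R x \<in> closure M"
    unfolding closure_sequential by (intro exI[of _ "\<lambda>k. r *\<^sub>R f k"]) simp
qed

text \<open>
  Where \<open>S\<close> has no spectrum in \<open>(c, 1)\<close>, the product \<open>(1 - S) (S - c)\<close> has no positive spectrum. With
  \<open>D = 1 - S\<close> this says \<open>(1 - c) \<langle>D x, x\<rangle> \<le> \<parallel>D x\<parallel>\<^sup>2\<close>, and the Cauchy-Schwarz inequality for
  the form of \<open>D\<close> turns it into \<open>(1 - c) \<parallel>y\<parallel>\<^sup>2 \<le> \<langle>D y, y\<rangle>\<close> on the range of \<open>D\<close>.
\<close>

lemma form_le_off_fixed_points:
  fixes S g :: "'h::{real_inner,complete_space} \<Rightarrow>\<^sub>L 'h"
  assumes S: "symmetric_op S" and S1: "\<And>x. inner (S x) x \<le> (norm x)\<^sup>2"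
    and g: "is_projection g" "\<And>x. g x = x \<longleftrightarrow> S x = x" and c: "c < 1"
    and bb: "\<And>t. c < t \<Longrightarrow> t < 1 \<Longrightarrow> \<exists>\<delta>>0. \<forall>x. \<delta> * norm x \<le> norm (S x - t *\<^sub>R x)"
    and u: "g u = 0"
  shows "inner (S u) u \<le> c * (norm u)\<^sup>2"
proof -
  define D where "D = id_blinfun - S"
  have D: "symmetric_op D" unfolding D_def using S by (intro symmetric_op_simps)
  have Dx: "D x = x - S x" for x by (simp add: D_def blinfun.bilinear_simps)
  have D0: "0 \<le> inner (D x) x" for x
    using S1[of x] by (simp add: Dx inner_diff_left power2_norm_eq_inner)
  define B where "B = D o\<^sub>L (S - c *\<^sub>R id_blinfun)"
  have Bx: "B x = (1 + c) *\<^sub>R S x - S (S x) - c *\<^sub>R x" for x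
    by (simp add: B_def Dx blinfun.bilinear_simps algebra_simps)
  have B: "symmetric_op B" unfolding B_def
    by (intro symmetric_op_compose symmetric_op_simps D S) (simp add: D_def op_distribs scaleR_right_diff_distrib)
  have BD: "inner (B x) x \<le> 0" for x
  proof (rule form_nonpos_of_bounded_below[OF B])
    fix \<mu> :: real assume \<mu>: "0 < \<mu>"
    define w where "w = (1 - c)\<^sup>2 - 4 * \<mu>"
    show "\<exists>\<delta>>0. \<forall>x. \<delta> * norm x \<le> norm (B x - \<mu> *\<^sub>R x)"
    proof (cases "0 \<le> w")
      case True
      define v where "v = sqrt w"
      have v: "v\<^sup>2 = w" "0 \<le> v" "v < 1 - c"
        using True \<mu> c by (auto simp: v_def w_def intro!: real_less_lsqrt)
      define t1 t2 where "t1 = (1 + c + v) / 2" and "t2 = (1 + c - v) / 2"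
      have sum: "t1 + t2 = 1 + c" by (simp add: t1_def t2_def field_simps)
      have bounds: "c < t1" "t1 < 1" "c < t2" "t2 < 1" using v(2,3) c by (simp_all add: t1_def t2_def)
      have prod: "t1 * t2 = c + \<mu>"
      proof -
        have "4 * (t1 * t2) = (1 + c)\<^sup>2 - v\<^sup>2" by (simp add: t1_def t2_def power2_eq_square field_simps)
        then show ?thesis unfolding v(1) by (simp add: w_def power2_eq_square algebra_simps)
      qed
      have "\<exists>\<delta>>0. \<forall>x. \<delta> * norm x \<le> norm (S (S x - t2 *\<^sub>R x) - t1 *\<^sub>R (S x - t2 *\<^sub>R x))"
        by (intro bounded_below_compose[of "\<lambda>x. S x - t1 *\<^sub>R x" "\<lambda>x. S x - t2 *\<^sub>R x"] bb bounds)
      moreover have "S (S x - t2 *\<^sub>R x) - t1 *\<^sub>R (S x - t2 *\<^sub>R x) = - (B x - \<mu> *\<^sub>R x)" for x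
      proof -
        have "S (S x - t2 *\<^sub>R x) - t1 *\<^sub>R (S x - t2 *\<^sub>R x)
            = S (S x) - (t1 + t2) *\<^sub>R S x + (t1 * t2) *\<^sub>R x"
          by (simp add: blinfun.bilinear_simps algebra_simps)
        then show ?thesis by (simp add: sum prod Bx algebra_simps)
      qed
      ultimately show ?thesis by (simp only: norm_minus_cancel)
    next
      case False
      define m where "m = (1 + c) / 2"
      have m: "c + \<mu> = m\<^sup>2 - w / 4" by (simp add: m_def w_def power2_eq_square field_simps)
      have "- w / 4 * norm x \<le> norm (B x - \<mu> *\<^sub>R x)" for x
      proof (cases "x = 0")
        case False
        have "inner (\<mu> *\<^sub>R x - B x) x = inner (S (S x)) x - 2 * m * inner (S x) x + (c + \<mu>) * inner x x"
          by (simp add: Bx m_def inner_diff_left inner_add_left algebra_simps)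
        also have "inner (S (S x)) x = inner (S x) (S x)" by (rule symmetric_opD[OF S])
        also have "inner (S x) (S x) - 2 * m * inner (S x) x + (c + \<mu>) * inner x x
            = (norm (S x - m *\<^sub>R x))\<^sup>2 - w / 4 * (norm x)\<^sup>2"
          unfolding m power2_norm_eq_inner
          by (simp add: inner_diff_left inner_diff_right inner_commute power2_eq_square algebra_simps)
        finally have "- w / 4 * (norm x)\<^sup>2 \<le> inner (\<mu> *\<^sub>R x - B x) x" by simp
        also have "\<dots> \<le> norm (B x - \<mu> *\<^sub>R x) * norm x"
          by (metis norm_cauchy_schwarz norm_minus_commute)
        finally have "(- w / 4 * norm x) * norm x \<le> norm (B x - \<mu> *\<^sub>R x) * norm x"
          by (simp add: power2_eq_square)
        then show ?thesis by (rule mult_right_le_imp_le) (use False in simp)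
      qed simp
      then show ?thesis using False by (intro exI[of _ "- w / 4"]) simp
    qed
  qed
  have range: "(1 - c) * (norm (D x))\<^sup>2 \<le> inner (D (D x)) (D x)" for x
  proof -
    define \<alpha> \<beta> \<gamma> where "\<alpha> = inner (D x) x" and "\<beta> = (norm (D x))\<^sup>2" and "\<gamma> = inner (D (D x)) (D x)"
    have "B x = D ((1 - c) *\<^sub>R x - D x)" by (simp add: B_def D_def blinfun.bilinear_simps algebra_simps)
    then have "inner (B x) x = (1 - c) * \<alpha> - \<beta>"
      using symmetric_opD[OF D, of "D x" x]
      by (simp add: \<alpha>_def \<beta>_def blinfun.bilinear_simps inner_diff_left power2_norm_eq_inner)
    then have "(1 - c) * \<alpha> \<le> \<beta>" using BD[of x] by simp
    have "0 \<le> \<gamma>" "0 \<le> \<beta>" using D0 by (auto simp: \<gamma>_def \<beta>_def)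
    have "\<beta>\<^sup>2 \<le> \<alpha> * \<gamma>"
      using form_cauchy_schwarz[OF D D0, of x "D x"] by (simp add: \<alpha>_def \<beta>_def \<gamma>_def power2_norm_eq_inner)
    then have "(1 - c) * \<beta>\<^sup>2 \<le> (1 - c) * (\<alpha> * \<gamma>)" using c by (intro mult_left_mono) auto
    also have "\<dots> \<le> \<beta> * \<gamma>"
      using mult_right_mono[OF \<open>(1 - c) * \<alpha> \<le> \<beta>\<close> \<open>0 \<le> \<gamma>\<close>] by (simp add: mult.assoc)
    finally have "(1 - c) * \<beta>\<^sup>2 \<le> \<beta> * \<gamma>" .
    then show ?thesis using \<open>0 \<le> \<beta>\<close> \<open>0 \<le> \<gamma>\<close> unfolding \<beta>_def[symmetric] \<gamma>_def[symmetric]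
      by (cases "\<beta> = 0") (auto simp: power2_eq_square)
  qed
  define V where "V = closure (range (blinfun_apply D))"
  have "subspace (range (blinfun_apply D))"
    by (auto simp: subspace_def image_iff simp flip: blinfun.add_right blinfun.scaleR_right)
      (metis blinfun.zero_right)
  then have "subspace V" unfolding V_def by (rule subspace_closure)
  moreover have "closed V" by (simp add: V_def)
  ultimately obtain p where p: "p \<in> V" "\<And>m. m \<in> V \<Longrightarrow> inner (u - p) m = 0"
    using hilbert_projection by blast
  have perp: "inner k v = 0" if k: "D k = 0" and v: "v \<in> V" for k v
  proof -
    have "closed {v. inner k v = 0}" by (intro closed_Collect_eq continuous_intros)
    moreover have "range (blinfun_apply D) \<subseteq> {v. inner k v = 0}"
      using k symmetric_opD[OF D, of k] by auto
    ultimately show ?thesis using v closure_minimal unfolding V_def by blast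
  qed
  have "inner (D (u - p)) y = 0" for y
  proof -
    have "D y \<in> V" unfolding V_def by (rule subsetD[OF closure_subset rangeI])
    then show ?thesis using p(2) symmetric_opD[OF D, of "u - p" y] by simp
  qed
  then have Dk: "D (u - p) = 0" by (metis inner_eq_zero_iff)
  then have "g (u - p) = u - p" by (simp add: g(2) Dx)
  then have "inner (u - p) u = 0" using is_projectionD(4)[OF g(1), of "u - p" u] u by simp
  moreover have "inner (u - p) p = 0" by (rule perp[OF Dk p(1)])
  ultimately have "inner (u - p) (u - p) = 0" by (simp add: inner_diff_right)
  then have uV: "u \<in> V" using p(1) by simp
  have "closed {y. (1 - c) * (norm y)\<^sup>2 \<le> inner (D y) y}"
    by (intro closed_Collect_le continuous_intros)
  then have "V \<subseteq> {y. (1 - c) * (norm y)\<^sup>2 \<le> inner (D y) y}"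
    unfolding V_def by (rule closure_minimal[rotated]) (use range in auto)
  then have "(1 - c) * (norm u)\<^sup>2 \<le> inner (D u) u" using uV by blast
  then show ?thesis by (simp add: Dx inner_diff_left power2_norm_eq_inner algebra_simps)
qed

locale projection_product = hilbert_space_over +
  fixes P :: "nat \<Rightarrow> 'b \<Rightarrow>\<^sub>L 'b" and n :: nat
  assumes P_mem: "k \<le> n \<Longrightarrow> P k \<in> bounded_ops smul" and P_proj: "k \<le> n \<Longrightarrow> is_projection (P k)"
begin

abbreviation "T \<equiv> op_prod P n"
abbreviation "S \<equiv> adj ip T o\<^sub>L T"
abbreviation "g \<equiv> proj_meet smul ip (P ` {..n})"

lemma g_projection: "g \<in> bounded_ops smul" "is_projection g"
  and g_fixed: "g x = x \<longleftrightarrow> (\<forall>k\<le>n. P k x = x)"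
  using proj_meet_projection[of "P ` {..n}"] P_mem P_proj by auto

lemma T_mem: "T \<in> bounded_ops smul"
  using op_algebra.op_prod_mem[OF op_algebra_bounded_ops] P_mem by blast

lemma T_norm_le: "norm (T x) \<le> norm x"
  using P_proj by (rule op_prod_norm_le)

lemma adj_T: "inner (adj ip T x) y = inner x (T y)"
  using inner_adj[OF T_mem, of y x] by (simp add: inner_commute)

lemma adj_T_norm_le: "norm (adj ip T x) \<le> norm x"
proof (cases "norm (adj ip T x) = 0")
  case False
  have "(norm (adj ip T x))\<^sup>2 = inner x (T (adj ip T x))" by (simp add: adj_T power2_norm_eq_inner)
  also have "\<dots> \<le> norm x * norm (T (adj ip T x))" by (rule norm_cauchy_schwarz)
  also have "\<dots> \<le> norm x * norm (adj ip T x)" by (intro mult_left_mono T_norm_le) simp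
  finally show ?thesis using False by (simp add: power2_eq_square)
qed simp

lemma S_inner: "inner (S x) y = inner (T x) (T y)"
  by (simp add: adj_T)

lemma S_form: "inner (S x) x = (norm (T x))\<^sup>2"
  by (simp only: S_inner power2_norm_eq_inner)

lemma S_symmetric: "symmetric_op S"
  unfolding symmetric_op_def by (metis S_inner inner_commute)

lemma adj_T_mem: "adj ip T \<in> bounded_ops smul"
proof -
  have "adj ip T (smul c x) = smul c (adj ip T x)" for c x
  proof -
    obtain c' :: 'a where c': "to_complex c' = cnj (to_complex c)" using to_complex_cnj_exists by blast
    define d where "d = adj ip T (smul c x) - smul c (adj ip T x)"
    have "inner (adj ip T (smul c x)) d = inner (smul c (adj ip T x)) d"
      by (simp add: adj_T inner_smul[OF c'] bounded_opsD[OF T_mem])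
    then have "inner d d = 0" by (subst (1) d_def) (simp add: inner_diff_left)
    then show ?thesis by (simp add: d_def)
  qed
  then show ?thesis by (simp add: bounded_ops_def)
qed

lemma S_mem: "S \<in> bounded_ops smul"
  by (intro op_algebra.compose_mem[OF op_algebra_bounded_ops] T_mem adj_T_mem)

lemma P_fixed_of_norm_T: "norm x \<le> norm (T x) \<Longrightarrow> g x = x"
  unfolding g_fixed using fixed_of_op_prod_norm P_proj by blast

lemma T_g: "T (g x) = g x"
  using g_fixed[of "g x"] is_projectionD(3)[OF g_projection(2)] by (intro op_prod_fixed) auto

lemma S_g: "S (g x) = g x"
proof -
  have fixed: "P k (g x) = g x" if "k \<le> n" for k
    using g_fixed[of "g x"] is_projectionD(3)[OF g_projection(2)] that by auto
  have "inner (adj ip T (g x) - g x) y = 0" for y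
  proof -
    have "inner (g x) (T y) = inner (g x) y" using P_proj fixed by (rule inner_fixed_op_prod)
    then show ?thesis by (simp add: adj_T inner_diff_left)
  qed
  then have "adj ip T (g x) = g x" by (metis inner_eq_zero_iff right_minus_eq)
  then show ?thesis by (simp add: T_g)
qed

lemma g_S: "g (S x) = g x"
proof -
  have "S o\<^sub>L g = g" by (rule blinfun_eqI) (simp only: blinfun_apply_blinfun_compose[of S g] S_g)
  moreover from this have "g o\<^sub>L S = S o\<^sub>L g"
    using symmetric_op_compose_commute[OF S_symmetric is_projectionD(1)[OF g_projection(2)]]
      is_projectionD(1)[OF g_projection(2)] by simp
  ultimately show ?thesis by (metis blinfun_apply_blinfun_compose)
qed

lemma S_fixed: "g x = x \<longleftrightarrow> S x = x"
proof
  assume "S x = x"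
  then have "(norm x)\<^sup>2 = (norm (T x))\<^sup>2" using S_form[of x] by (simp add: power2_norm_eq_inner)
  then show "g x = x" by (intro P_fixed_of_norm_T) simp
qed (metis S_g)

lemma gapD:
  assumes gap: "spectral_gap_at_one smul S"
  obtains r where "0 \<le> r" "r < 1" "\<And>u. g u = 0 \<Longrightarrow> (norm (T u))\<^sup>2 \<le> r * (norm u)\<^sup>2"
proof -
  define sup where "sup = (SUP c \<in> op_spectrum smul S - {1}. ereal (Re (to_complex c)))"
  have "sup < 1" using gap by (simp add: spectral_gap_at_one_def sup_def)
  then obtain c where c: "sup < ereal c" "c < 1" using ereal_dense2[of sup 1] by auto
  have bb: "\<exists>\<delta>>0. \<forall>x. \<delta> * norm x \<le> norm (S x - t *\<^sub>R x)" if t: "c < t" "t < 1" for t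
  proof -
    have ne1: "(of_real t :: 'a) \<noteq> 1" using t by (metis less_irrefl of_real_eq_1_iff)
    have "of_real t \<notin> op_spectrum smul S"
    proof
      assume "of_real t \<in> op_spectrum smul S"
      then have "ereal (Re (to_complex (of_real t :: 'a))) \<le> sup"
        unfolding sup_def using ne1 by (intro SUP_upper) auto
      then have "ereal t \<le> sup" by (simp add: to_complex_of_real)
      then show False using c t by (meson ereal_less_eq(3) leD less_imp_le order_le_less_trans)
    qed
    then obtain R where R: "R o\<^sub>L (S - smul_op smul (of_real t) id_blinfun) = id_blinfun"
      unfolding op_spectrum_def by blast
    show ?thesis
    proof (rule bounded_below_of_left_inverse[where L = R and K = "norm R"])
      show "R (S x - t *\<^sub>R x) = x" for x
        using compose_eqD[OF R, of x] by (simp add: smul_op_of_real blinfun.bilinear_simps)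
    qed (rule norm_blinfun)
  qed
  have "inner (S u) u \<le> c * (norm u)\<^sup>2" if u: "g u = 0" for u
  proof (rule form_le_off_fixed_points[OF S_symmetric _ g_projection(2) S_fixed c(2) bb u])
    show "inner (S x) x \<le> (norm x)\<^sup>2" for x unfolding S_form by (intro power_mono T_norm_le) simp
  qed
  then have "(norm (T u))\<^sup>2 \<le> max 0 c * (norm u)\<^sup>2" if "g u = 0" for u
    using that unfolding S_form by (meson max.cobounded2 mult_right_mono order_trans zero_le_power2)
  then show ?thesis using that[of "max 0 c"] c by simp
qed

lemma norm_S_diff_g_le:
  assumes r: "0 \<le> r" "\<And>u. g u = 0 \<Longrightarrow> (norm (T u))\<^sup>2 \<le> r * (norm u)\<^sup>2"
  shows "norm (S - g) \<le> sqrt r"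
proof (rule norm_blinfun_bound)
  fix x
  define u where "u = x - g x"
  have gu: "g u = 0" using is_projectionD(3)[OF g_projection(2)] by (simp add: u_def blinfun.bilinear_simps)
  have "(S - g) x = adj ip T (T u)"
    using S_g[of x] by (simp add: u_def blinfun.bilinear_simps)
  also have "norm \<dots> \<le> norm (T u)" by (rule adj_T_norm_le)
  also have "\<dots> \<le> sqrt (r * (norm u)\<^sup>2)" by (rule real_le_rsqrt[OF r(2)[OF gu]])
  also have "\<dots> = sqrt r * norm u" by (simp add: real_sqrt_mult)
  also have "\<dots> \<le> sqrt r * norm x"
  proof (intro mult_left_mono)
    show "norm u \<le> norm x" unfolding u_def
      by (rule power2_le_imp_le) (simp_all add: projection_pythagoras[OF g_projection(2), of x])
  qed (use r in simp)
  finally show "norm ((S - g) x) \<le> sqrt r * norm x" .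
qed (use r in simp)

lemma gapI:
  assumes r: "0 \<le> r" "r < 1" "\<And>u. g u = 0 \<Longrightarrow> (norm (T u))\<^sup>2 \<le> r * (norm u)\<^sup>2"
  shows "spectral_gap_at_one smul S"
proof -
  interpret BO: op_algebra "bounded_ops smul" by (rule op_algebra_bounded_ops)
  define \<rho> where "\<rho> = sqrt r"
  have \<rho>: "0 \<le> \<rho>" "\<rho> < 1" using r by (auto simp: \<rho>_def)
  define Q where "Q = S - g"
  have nQ: "norm Q \<le> \<rho>" unfolding Q_def \<rho>_def by (rule norm_S_diff_g_le[OF r(1,3)])
  have Qx: "norm (Q x) \<le> \<rho> * norm x" for x
    by (rule order_trans[OF norm_blinfun mult_right_mono[OF nQ]]) simp
  have QB: "Q \<in> bounded_ops smul" unfolding Q_def by (intro BO.mems S_mem g_projection)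
  have SQ: "S x = Q x + g x" for x by (simp add: Q_def blinfun.bilinear_simps)
  have gg: "g (g x) = g x" for x by (rule is_projectionD(3)[OF g_projection(2)])
  have gQ: "g (Q x) = 0" for x
    using g_S[of x] unfolding SQ by (simp add: blinfun.bilinear_simps gg)
  have "Re (to_complex c) \<le> \<rho>" if c: "c \<in> op_spectrum smul S" "c \<noteq> 1" for c
  proof (rule ccontr)
    assume "\<not> ?thesis"
    then have c\<rho>: "\<rho> < cmod (to_complex c)" using complex_Re_le_cmod[of "to_complex c"] by linarith
    then have c0: "c \<noteq> 0" using \<rho> by (auto simp: to_complex_zero)
    define v where "v = smul_op smul (inverse c) Q"
    have vx: "v x = smul (inverse c) (Q x)" for x by (simp add: v_def smul_op_apply)
    have vB: "v \<in> bounded_ops smul" unfolding v_def by (rule smul_op_mem_bounded_ops[OF QB])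
    have "norm v \<le> \<rho> / cmod (to_complex c)"
    proof (rule norm_blinfun_bound)
      fix x show "norm (v x) \<le> \<rho> / cmod (to_complex c) * norm x"
        using divide_right_mono[OF Qx[of x], of "cmod (to_complex c)"] c0
        by (simp add: vx norm_smul to_complex_inverse norm_inverse divide_inverse algebra_simps)
    qed (use \<rho> in simp)
    also have "\<dots> < 1" using c\<rho> \<rho> by (auto simp: divide_less_eq_1)
    finally obtain s where s: "s \<in> bounded_ops smul" "s = v + (v o\<^sub>L s)"
      using BO.quasi_inverse[OF vB] by metis
    have sx: "s x = v x + v (s x)" for x by (subst s(2)) (simp add: blinfun.bilinear_simps)
    have gv: "g (v x) = 0" for x by (simp add: vx bounded_opsD[OF g_projection(1)] gQ)
    have gs: "g (s x) = 0" for x by (subst sx) (simp add: blinfun.bilinear_simps gv)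
    define R where "R = smul_op smul (- inverse c) ((id_blinfun + s) o\<^sub>L (id_blinfun - g))
        + smul_op smul (inverse (1 - c)) g"
    have RB: "R \<in> bounded_ops smul" unfolding R_def
      by (intro BO.mems smul_op_mem_bounded_ops s id_mem_bounded_ops g_projection)
    have right: "S (R x) - smul c (R x) = x" for x
    proof -
      define y where "y = (x - g x) + s (x - g x)"
      have Rx: "R x = smul (- inverse c) y + smul (inverse (1 - c)) (g x)"
        by (simp add: R_def y_def smul_op_apply blinfun.bilinear_simps)
      have gy: "g y = 0" by (simp add: y_def blinfun.add_right gs) (simp add: blinfun.diff_right gg)
      have "v y = s (x - g x)" unfolding y_def by (subst (2) sx) (simp add: blinfun.add_right)
      then have "smul (inverse c) (Q y) = y - (x - g x)" by (simp add: vx[symmetric] y_def)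
      then have "smul c (smul (inverse c) (Q y)) = smul c (y - (x - g x))" by simp
      then have Sy: "S y = smul c (y - (x - g x))" using c0 SQ[of y] gy by simp
      have "S (R x) = smul (- inverse c) (S y) + smul (inverse (1 - c)) (S (g x))"
        unfolding Rx by (simp only: blinfun.add_right bounded_opsD[OF S_mem])
      also have "\<dots> = - (y - (x - g x)) + smul (inverse (1 - c)) (g x)"
        unfolding Sy S_g using c0 by simp
      finally have SR: "S (R x) = - (y - (x - g x)) + smul (inverse (1 - c)) (g x)" .
      have cR: "smul c (R x) = - y + smul (c * inverse (1 - c)) (g x)"
        unfolding Rx scale_right_distrib scale_scale using c0 by simp
      have "S (R x) - smul c (R x) = x - g x + smul ((1 - c) * inverse (1 - c)) (g x)"
        unfolding SR cR by (simp add: left_diff_distrib scale_left_diff_distrib)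
      also have "\<dots> = x" using c(2) by simp
      finally show ?thesis .
    qed
    have inj: "w = 0" if w: "S w - smul c w = 0" for w
    proof -
      have Sw: "S w = smul c w" using w by simp
      then have "g w = smul c (g w)" using g_S[of w] bounded_opsD[OF g_projection(1)] by metis
      then have "smul (1 - c) (g w) = 0" by (simp add: scale_left_diff_distrib)
      then have "g w = 0" using c(2) by simp
      then have "Q w = smul c w" using Sw SQ[of w] by simp
      then have "norm (Q w) = cmod (to_complex c) * norm w" by (simp add: norm_smul)
      then have "cmod (to_complex c) * norm w \<le> \<rho> * norm w" using Qx[of w] by simp
      then show ?thesis using c\<rho> by (simp add: mult_le_cancel_right)
    qed
    define C where "C = S - smul_op smul c id_blinfun"
    have Cx: "C x = S x - smul c x" for x by (simp add: C_def blinfun.bilinear_simps smul_op_apply)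
    have CR: "C o\<^sub>L R = id_blinfun" by (rule blinfun_eqI) (use right in \<open>simp add: Cx\<close>)
    moreover have "R o\<^sub>L C = id_blinfun"
    proof (rule blinfun_eqI)
      fix x
      have "C (R (C x) - x) = 0" using compose_eqD[OF CR] by (simp add: blinfun.diff_right)
      then have "R (C x) - x = 0" using inj unfolding Cx by blast
      then show "(R o\<^sub>L C) x = id_blinfun x" by simp
    qed
    ultimately show False using c(1) RB unfolding op_spectrum_def C_def by blast
  qed
  then have "(SUP c \<in> op_spectrum smul S - {1}. ereal (Re (to_complex c))) \<le> ereal \<rho>"
    by (intro SUP_least) auto
  also have "\<dots> < 1" using \<rho> by simp
  finally show ?thesis by (simp add: spectral_gap_at_one_def)
qed

end

section \<open>Homomorphic images\<close>

lemma projection_eqI: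
  assumes P: "is_projection P" and Q: "is_projection Q" and eq: "\<And>x. P x = x \<longleftrightarrow> Q x = x"
  shows "P = Q"
proof -
  have "P o\<^sub>L Q = Q" by (rule blinfun_eqI) (use eq is_projectionD(3)[OF Q] in simp)
  moreover have "Q o\<^sub>L P = P" by (rule blinfun_eqI) (use eq is_projectionD(3)[OF P] in simp)
  ultimately show ?thesis
    using symmetric_op_compose_commute[of P Q] is_projectionD(1) P Q by metis
qed

lemma real_op_hom_of_cstar_hom:
  assumes H: "hilbert_space_over smul ip" and K: "hilbert_space_over smul' ip'"
    and A: "cstar_algebra_on smul ip A" and B: "cstar_algebra_on smul' ip' B"
    and \<pi>: "cstar_hom smul ip A smul' ip' B \<pi>"
  shows "real_op_hom A \<pi>"
proof -
  interpret H: hilbert_space_over smul ip by fact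
  interpret K: hilbert_space_over smul' ip' by fact
  interpret op_algebra A by (rule H.op_algebra_of_cstar_algebra_on[OF A])
  have AB: "A \<subseteq> bounded_ops smul" and BB: "B \<subseteq> bounded_ops smul'"
    using A B by (simp_all add: cstar_algebra_on_def)
  have \<pi>B: "\<pi> ` A \<subseteq> B" and hom_smul: "\<And>a c. a \<in> A \<Longrightarrow> \<pi> (smul_op smul c a) = smul_op smul' c (\<pi> a)"
    and hom_adj: "\<And>a. a \<in> A \<Longrightarrow> \<pi> (adj ip a) = adj ip' (\<pi> a)"
    using \<pi> by (simp_all add: cstar_hom_def)
  show ?thesis
  proof
    show "\<pi> (r *\<^sub>R a) = r *\<^sub>R \<pi> a" if "a \<in> A" for a r
      using hom_smul[OF that, of "of_real r"] by (simp only: H.smul_op_of_real K.smul_op_of_real)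
    show "symmetric_op (\<pi> a)" if a: "a \<in> A" "symmetric_op a" for a
    proof -
      have "adj ip a = a" using H.adj_eq_self_iff[OF subsetD[OF AB a(1)]] a(2) by blast
      then have "adj ip' (\<pi> a) = \<pi> a" using hom_adj[OF a(1)] by simp
      moreover have "\<pi> a \<in> bounded_ops smul'" using \<pi>B BB a(1) by blast
      ultimately show ?thesis using K.adj_eq_self_iff by blast
    qed
  qed (use \<pi> in \<open>auto simp: cstar_hom_def\<close>)
qed

locale hom_of_projection_product =
  H: projection_product smul ip P n + real_op_hom A \<pi> + K: projection_product smul' ip' "\<lambda>k. \<pi> (P k)" n
  for smul :: "'f::real_or_complex_field \<Rightarrow> 'h::{real_inner,complete_space} \<Rightarrow> 'h"
    and ip and smul' :: "'f \<Rightarrow> 'k::{real_inner,complete_space} \<Rightarrow> 'k" and ip' and A P n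
    and \<pi> :: "('h \<Rightarrow>\<^sub>L 'h) \<Rightarrow> ('k \<Rightarrow>\<^sub>L 'k)" +
  assumes P_A: "k \<le> n \<Longrightarrow> P k \<in> A" and adj_A: "a \<in> A \<Longrightarrow> adj ip a \<in> A"
    and hom_adj: "a \<in> A \<Longrightarrow> \<pi> (adj ip a) = adj ip' (\<pi> a)"
begin

lemma T_A: "H.T \<in> A"
  by (rule op_prod_mem[OF P_A])

lemma S_A: "H.S \<in> A"
  by (intro compose_mem adj_A T_A)

lemma hom_S: "\<pi> H.S = K.S"
  using hom_op_prod[OF P_A, of n] by (simp add: hom_compose adj_A T_A hom_adj)

lemma hom_projection: "a \<in> A \<Longrightarrow> is_projection a \<Longrightarrow> is_projection (\<pi> a)"
  unfolding is_projection_def using hom_symmetric hom_compose[of a a] by simp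

lemma meet_preserved:
  assumes gap: "spectral_gap_at_one smul H.S"
  shows "H.g \<in> A" "\<pi> H.g = K.g"
proof -
  obtain r where r: "0 \<le> r" "r < 1" "\<And>u. H.g u = 0 \<Longrightarrow> (norm (H.T u))\<^sup>2 \<le> r * (norm u)\<^sup>2"
    using H.gapD[OF gap] by metis
  define Q where "Q = H.S - H.g"
  have nQ: "norm Q < 1" using H.norm_S_diff_g_le[OF r(1,3)] r(2) by (simp add: Q_def order_le_less_trans)
  have Sg: "H.S o\<^sub>L H.g = H.g" and gS: "H.g o\<^sub>L H.S = H.g"
    using H.S_g H.g_S by (auto intro!: blinfun_eqI)
  have gg: "H.g o\<^sub>L H.g = H.g" by (rule is_projectionD(2)[OF H.g_projection(2)])
  define X where "X = rec_nat H.S (\<lambda>_ x. H.S o\<^sub>L x)"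
  have X0: "X 0 = H.S" and XS: "X (Suc k) = H.S o\<^sub>L X k" for k by (auto simp: X_def)
  have XA: "X k \<in> A" for k by (induction k) (auto simp only: X0 XS intro!: S_A compose_mem[OF S_A])
  have gX: "H.g o\<^sub>L X k = H.g" for k
  proof (induction k)
    case (Suc k)
    have "H.g o\<^sub>L X (Suc k) = (H.g o\<^sub>L H.S) o\<^sub>L X k" unfolding XS by (rule op_assoc[symmetric])
    then show ?case unfolding gS Suc .
  qed (simp only: X0 gS)
  have "norm (X k - H.g) \<le> norm Q ^ Suc k" for k
  proof (induction k)
    case (Suc k)
    have "X (Suc k) - H.g = Q o\<^sub>L (X k - H.g)"
      by (simp only: Q_def XS op_distribs Sg gX gg) simp
    then have "norm (X (Suc k) - H.g) \<le> norm Q * norm (X k - H.g)" by (simp add: norm_blinfun_compose)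
    also have "\<dots> \<le> norm Q * norm Q ^ Suc k" by (intro mult_left_mono Suc) simp
    finally show ?case by simp
  qed (simp add: X0 Q_def)
  then have "(\<lambda>k. X k - H.g) \<longlonglongrightarrow> 0"
    using nQ by (intro Lim_null_comparison[OF _ LIMSEQ_Suc[OF LIMSEQ_power_zero[of "norm Q"]]]) auto
  then have "X \<longlonglongrightarrow> H.g" by (simp add: LIM_zero_iff)
  then show gA: "H.g \<in> A" by (rule limit_mem[OF XA])
  have QA: "Q \<in> A" unfolding Q_def by (rule diff_mem[OF S_A gA])
  have g': "is_projection (\<pi> H.g)" by (rule hom_projection[OF gA H.g_projection(2)])
  have "\<pi> H.g x = x \<longleftrightarrow> K.g x = x" for x
  proof
    assume x: "\<pi> H.g x = x"
    have "\<pi> (P k) x = x" if "k \<le> n" for k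
    proof -
      have "P k (H.g y) = H.g y" for y
        using H.g_fixed[of "H.g y"] compose_eqD[OF gg] that by simp
      then have "P k o\<^sub>L H.g = H.g" by (intro blinfun_eqI) simp
      then have "\<pi> (P k) o\<^sub>L \<pi> H.g = \<pi> H.g" using hom_compose[OF P_A[OF that] gA] by simp
      then show ?thesis using compose_eqD x by metis
    qed
    then show "K.g x = x" by (simp add: K.g_fixed)
  next
    assume "K.g x = x"
    then have Sx: "\<pi> H.S x = x" unfolding hom_S by (simp only: K.S_fixed)
    have "\<pi> H.S o\<^sub>L \<pi> H.g = \<pi> H.g" using hom_compose[OF S_A gA] Sg by simp
    note Sg' = compose_eqD[OF this]
    define z where "z = x - \<pi> H.g x"
    have "\<pi> H.g z = 0" by (simp add: z_def blinfun.diff_right is_projectionD(3)[OF g'])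
    then have "\<pi> Q z = z"
      unfolding Q_def hom_diff[OF S_A gA] by (simp only: blinfun.diff_left) (simp only: z_def blinfun.diff_right Sx Sg', simp)
    obtain L where L: "\<And>x. L (x - \<pi> Q x) = x" "bounded_linear L"
      using hom_left_quasi_inverse[OF QA nQ] by blast
    have "z = L 0" using L(1)[of z] \<open>\<pi> Q z = z\<close> by simp
    then have "z = 0" using linear_simps(3)[OF L(2)] by simp
    then show "\<pi> H.g x = x" by (simp add: z_def)
  qed
  then show "\<pi> H.g = K.g" by (intro projection_eqI g' K.g_projection)
qed

lemma compact_projection_contradiction:
  assumes E: "E \<in> compact_ops smul" and Ey: "(\<lambda>k. E (y k) - y k) \<longlonglongrightarrow> 0"
    and y: "\<And>k. norm (y k) = 1" "\<And>k. H.g (y k) = 0" and Sy: "(\<lambda>k. H.S (y k) - y k) \<longlonglongrightarrow> 0"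
  shows False
proof -
  have "compact (closure (blinfun_apply E ` cball 0 1))" using E by (simp add: compact_ops_def)
  moreover have "\<forall>k. E (y k) \<in> closure (blinfun_apply E ` cball 0 1)"
    using y(1) by (auto intro!: closure_subset[THEN subsetD])
  ultimately obtain l s where s: "strict_mono s" and l: "(\<lambda>k. E (y (s k))) \<longlonglongrightarrow> l"
    unfolding compact_eq_seq_compact_metric seq_compact_def by (force simp: o_def)
  have "(\<lambda>k. E (y (s k)) - (E (y (s k)) - y (s k))) \<longlonglongrightarrow> l - 0"
    by (intro tendsto_diff l) (use LIMSEQ_subseq_LIMSEQ[OF Ey s] in \<open>simp add: o_def\<close>)
  then have yl: "(\<lambda>k. y (s k)) \<longlonglongrightarrow> l" by simp
  have "norm l = 1"
    using tendsto_norm[OF yl] y(1) by (simp add: LIMSEQ_const_iff)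
  have "H.g l = 0"
  proof -
    have "(\<lambda>k. H.g (y (s k))) \<longlonglongrightarrow> H.g l" by (intro blinfun.tendsto tendsto_const yl)
    then show ?thesis using y(2) by (simp add: LIMSEQ_const_iff)
  qed
  have "(\<lambda>k. H.S (y (s k)) - y (s k)) \<longlonglongrightarrow> H.S l - l"
    by (intro tendsto_diff blinfun.tendsto tendsto_const yl)
  moreover have "(\<lambda>k. H.S (y (s k)) - y (s k)) \<longlonglongrightarrow> 0"
    using LIMSEQ_subseq_LIMSEQ[OF Sy s] by (simp add: o_def)
  ultimately have "H.S l - l = 0" by (rule LIMSEQ_unique)
  then have "H.g l = l" unfolding H.S_fixed by simp
  then show False using \<open>H.g l = 0\<close> \<open>norm l = 1\<close> by simp
qed

lemma gap_of_meet_preserved: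
  assumes A: "cstar_algebra_on smul ip A" and B: "cstar_algebra_on smul' ip' B" and \<pi>B: "\<pi> ` A \<subseteq> B"
    and rr: "real_rank_zero smul ip A" and sc: "sigma_closed proj_le 0 (projections ip' B)"
    and ker: "{a \<in> A. \<pi> a = 0} \<subseteq> compact_ops smul"
    and R: "R \<in> projections ip A" "\<And>k. k \<le> n \<Longrightarrow> proj_le R (P k)"
    and glb: "is_glb proj_le (projections ip' B) ((\<lambda>k. \<pi> (P k)) ` {..n}) (\<pi> R)"
  shows "spectral_gap_at_one smul H.S"
proof (rule ccontr)
  assume nogap: "\<not> spectral_gap_at_one smul H.S"
  have AB: "A \<subseteq> bounded_ops smul" and BB: "B \<subseteq> bounded_ops smul'"
    using A B by (auto simp: cstar_algebra_on_def)
  note projB = K.mem_projections_iff[OF BB]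
  have RA: "R \<in> A" and Rp: "is_projection R" using R(1) H.mem_projections_iff[OF AB] by auto
  have "\<exists>u. norm u = 1 \<and> H.g u = 0 \<and> 1 - 1 / real (Suc k) < (norm (H.T u))\<^sup>2" for k
  proof -
    have "\<not> (\<forall>u. H.g u = 0 \<longrightarrow> (norm (H.T u))\<^sup>2 \<le> (1 - 1 / real (Suc k)) * (norm u)\<^sup>2)"
      using H.gapI[of "1 - 1 / real (Suc k)"] nogap by auto
    then obtain u where u: "H.g u = 0" "(1 - 1 / real (Suc k)) * (norm u)\<^sup>2 < (norm (H.T u))\<^sup>2"
      by (auto simp: not_le)
    then have "u \<noteq> 0" by auto
    define v where "v = (1 / norm u) *\<^sub>R u"
    have "(norm (H.T v))\<^sup>2 = (norm (H.T u))\<^sup>2 / (norm u)\<^sup>2"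
      by (simp add: v_def blinfun.scaleR_right power_divide)
    moreover have "0 < (norm u)\<^sup>2" using \<open>u \<noteq> 0\<close> by simp
    ultimately have "1 - 1 / real (Suc k) < (norm (H.T v))\<^sup>2"
      using u(2) by (simp only: pos_less_divide_eq)
    moreover have "norm v = 1" "H.g v = 0" using \<open>u \<noteq> 0\<close> u(1) by (auto simp: v_def blinfun.scaleR_right)
    ultimately show ?thesis by blast
  qed
  then obtain y where y: "\<And>k. norm (y k) = 1" "\<And>k. H.g (y k) = 0"
      and Ty: "\<And>k. 1 - 1 / real (Suc k) < (norm (H.T (y k)))\<^sup>2" by metis
  have Sy: "(\<lambda>k. H.S (y k) - y k) \<longlonglongrightarrow> 0"
  proof -
    have "(norm (H.S (y k) - y k))\<^sup>2 \<le> inverse (real (Suc k))" for k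
    proof -
      have "norm (H.S (y k)) \<le> norm (H.T (y k))" using H.adj_T_norm_le by simp
      then have "(norm (H.S (y k)))\<^sup>2 \<le> (norm (H.T (y k)))\<^sup>2" by (intro power_mono) auto
      moreover have "(norm (H.S (y k) - y k))\<^sup>2 = (norm (H.S (y k)))\<^sup>2 - 2 * (norm (H.T (y k)))\<^sup>2 + 1"
        using y(1)[of k] H.S_form[of "y k"]
        by (simp only: power2_norm_eq_inner inner_diff_left inner_diff_right inner_commute[of "y k" "H.S (y k)"])
          (simp add: power2_norm_eq_inner norm_eq_1)
      ultimately show ?thesis using Ty[of k] unfolding inverse_eq_divide by linarith
    qed
    then have "(\<lambda>k. (norm (H.S (y k) - y k))\<^sup>2) \<longlonglongrightarrow> 0"
      by (intro Lim_null_comparison[OF _ LIMSEQ_inverse_real_of_nat]) auto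
    from tendsto_real_sqrt[OF this] show ?thesis by (simp add: tendsto_norm_zero_iff)
  qed
  have gR: "H.g (R x) = R x" for x
    using R(2) H.proj_le_iff[OF Rp H.P_proj] is_projectionD(3)[OF Rp] unfolding H.g_fixed by blast
  then have "H.g o\<^sub>L R = R" by (intro blinfun_eqI) simp
  then have "R o\<^sub>L H.g = R"
    using symmetric_op_compose_commute[OF is_projectionD(1)[OF H.g_projection(2)] is_projectionD(1)[OF Rp]]
      is_projectionD(1)[OF Rp] by simp
  then have Ry: "R (y k) = 0" for k using compose_eqD[of R "H.g" R "y k"] y(2) by simp
  define a where "a = H.S - R"
  have aA: "a \<in> A" unfolding a_def by (intro diff_mem S_A RA)
  have asym: "symmetric_op a" unfolding a_def
    by (intro symmetric_op_simps H.S_symmetric is_projectionD(1)[OF Rp])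
  obtain A1 e where A1: "unital_real_rank_zero A1 e" "A \<subseteq> A1"
    and near: "\<And>E a. E \<in> A1 \<Longrightarrow> is_projection E \<Longrightarrow> a \<in> A \<Longrightarrow> norm (E o\<^sub>L (e - a) o\<^sub>L E) < 1 \<Longrightarrow> E \<in> A"
    using H.real_rank_zero_unitization[OF A rr] by blast
  interpret A1: unital_real_rank_zero A1 e by (rule A1(1))
  define d where "d = e - a"
  have dA1: "d \<in> A1" unfolding d_def using A1(2) aA A1.unit_mem by (intro A1.diff_mem) auto
  have dsym: "symmetric_op d" unfolding d_def
    by (intro symmetric_op_simps asym is_projectionD(1)[OF A1.unit_projection])
  have ey: "(\<lambda>k. e (y k) - y k) \<longlonglongrightarrow> 0"
  proof -
    have "e o\<^sub>L H.S = H.S" using A1.unit_left A1(2) S_A by blast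
    note eS = compose_eqD[OF this]
    have "(\<lambda>k. (H.S (y k) - y k) - e (H.S (y k) - y k)) \<longlonglongrightarrow> 0 - e 0"
      by (intro tendsto_diff blinfun.tendsto tendsto_const Sy)
    then show ?thesis unfolding blinfun.diff_right[of e] eS by simp
  qed
  have dy: "(\<lambda>k. d (y k)) \<longlonglongrightarrow> 0"
  proof -
    have "(\<lambda>k. (e (y k) - y k) - (H.S (y k) - y k)) \<longlonglongrightarrow> 0 - 0" by (intro tendsto_diff ey Sy)
    moreover have "d (y k) = (e (y k) - y k) - (H.S (y k) - y k)" for k
      unfolding d_def a_def blinfun.diff_left Ry by simp
    ultimately show ?thesis by simp
  qed
  from A1.decreasing_projections[OF dA1 dsym dy ey] obtain E :: "nat \<Rightarrow> 'h \<Rightarrow>\<^sub>L 'h"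
    where E: "\<And>n. E n \<in> A1" "\<And>n. is_projection (E n)" "\<And>n. E (Suc n) o\<^sub>L E n = E (Suc n)"
      "\<And>n. (\<lambda>k. E n (y k) - y k) \<longlonglongrightarrow> 0"
      "(\<lambda>n. norm (E n o\<^sub>L d o\<^sub>L E n)) \<longlonglongrightarrow> 0" by blast
  obtain N where N: "\<And>m. m \<ge> N \<Longrightarrow> norm (E m o\<^sub>L d o\<^sub>L E m) < 1"
    using order_tendstoD(2)[OF E(5), of 1] by (auto simp: eventually_sequentially)
  define F where "F m = E (m + N)" for m
  have FA: "F m \<in> A" for m
    unfolding F_def using near[OF E(1,2) aA] N[of "m + N"] by (simp add: d_def)
  have Fp: "is_projection (F m)" for m by (simp add: F_def E(2))
  have "\<pi> (F m) \<noteq> 0" for m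
  proof
    assume "\<pi> (F m) = 0"
    then have "F m \<in> compact_ops smul" using ker FA by blast
    then show False
      by (rule compact_projection_contradiction[OF _ _ y Sy]) (simp add: F_def E(4))
  qed
  moreover have "\<pi> (F m) \<in> projections ip' B" for m
    unfolding projB using FA \<pi>B hom_projection[OF FA Fp] by blast
  moreover have "proj_le (\<pi> (F (Suc m))) (\<pi> (F m))" for m
    using hom_compose[OF FA FA, of "Suc m" m] E(3)[of "m + N"] by (simp add: proj_le_def F_def)
  ultimately have seq: "\<forall>m. \<pi> (F m) \<in> projections ip' B \<and> \<pi> (F m) \<noteq> 0 \<and>
      proj_le (\<pi> (F (Suc m))) (\<pi> (F m))" by simp
  have "\<exists>q\<in>projections ip' B. q \<noteq> 0 \<and> (\<forall>m. proj_le q (\<pi> (F m)))"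
    by (rule sc[unfolded sigma_closed_def, THEN spec, THEN mp, OF seq])
  then obtain q where q: "q \<in> projections ip' B" "q \<noteq> 0" "\<And>m. proj_le q (\<pi> (F m))" by blast
  have qp: "is_projection q" using q(1) projB by blast
  have fixed: "K.g x = x \<and> \<pi> R x = 0" if x: "q x = x" for x
  proof -
    have Fx: "\<pi> (F m) x = x" for m
      using q(3) K.proj_le_iff[OF qp hom_projection[OF FA Fp]] x by blast
    have \<pi>a: "inner (\<pi> a x) x = (norm (K.T x))\<^sup>2 - (norm (\<pi> R x))\<^sup>2"
      unfolding a_def hom_diff[OF S_A RA] hom_S blinfun.diff_left inner_diff_left K.S_form
        projection_form[OF hom_projection[OF RA Rp]] ..
    have le: "(norm x)\<^sup>2 - inner (\<pi> a x) x \<le> norm (F m o\<^sub>L d o\<^sub>L F m) * (norm x)\<^sup>2" for m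
    proof -
      have FdF: "F m o\<^sub>L d o\<^sub>L F m = F m - (F m o\<^sub>L a o\<^sub>L F m)"
        using A1.unit_right[OF subsetD[OF A1(2) FA[of m]]] is_projectionD(2)[OF Fp[of m]]
        by (simp add: d_def op_distribs)
      have FaF: "F m o\<^sub>L a o\<^sub>L F m \<in> A" by (intro compose_mem FA aA)
      have mem: "F m o\<^sub>L d o\<^sub>L F m \<in> A" unfolding FdF by (intro diff_mem FA FaF)
      have sym: "symmetric_op (F m o\<^sub>L d o\<^sub>L F m)"
        by (rule symmetric_op_conj[OF is_projectionD(1)[OF Fp] dsym])
      have "\<pi> (F m o\<^sub>L d o\<^sub>L F m) x = x - \<pi> (F m) (\<pi> a x)"
        unfolding FdF hom_diff[OF FA FaF]
        by (simp add: hom_compose compose_mem FA aA blinfun.diff_left Fx)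
      moreover have "inner (\<pi> (F m) (\<pi> a x)) x = inner (\<pi> a x) x"
        using is_projectionD(4)[OF hom_projection[OF FA Fp]] Fx by simp
      ultimately show ?thesis using hom_form_le[OF mem sym, of x]
        by (simp add: inner_diff_left power2_norm_eq_inner)
    qed
    have "(\<lambda>m. norm (F m o\<^sub>L d o\<^sub>L F m) * (norm x)\<^sup>2) \<longlonglongrightarrow> 0 * (norm x)\<^sup>2"
      unfolding F_def by (intro tendsto_mult tendsto_const LIMSEQ_ignore_initial_segment[OF E(5)])
    then have "(norm x)\<^sup>2 - inner (\<pi> a x) x \<le> 0 * (norm x)\<^sup>2"
      by (rule LIMSEQ_le_const) (use le in blast)
    then have ge: "(norm x)\<^sup>2 + (norm (\<pi> R x))\<^sup>2 \<le> (norm (K.T x))\<^sup>2" by (simp add: \<pi>a)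
    moreover have "(norm (K.T x))\<^sup>2 \<le> (norm x)\<^sup>2" by (intro power_mono K.T_norm_le) simp
    ultimately have "(norm (\<pi> R x))\<^sup>2 \<le> 0" by linarith
    then have "\<pi> R x = 0" by simp
    moreover have "norm x \<le> norm (K.T x)" by (rule power2_le_imp_le) (use ge \<open>\<pi> R x = 0\<close> in simp_all)
    ultimately show ?thesis using K.P_fixed_of_norm_T by blast
  qed
  have "proj_le q (\<pi> (P k))" if "k \<le> n" for k
    using fixed that K.g_fixed K.proj_le_iff[OF qp K.P_proj[OF that]] by blast
  then have "proj_le q (\<pi> R)" using glb q(1) unfolding is_glb_def by blast
  then have "\<pi> R x = x" if "q x = x" for x
    using K.proj_le_iff[OF qp hom_projection[OF RA Rp]] that by blast
  then have "q x = 0" for x using fixed[of "q x"] is_projectionD(3)[OF qp, of x] by metis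
  then have "q = 0" by (intro blinfun_eqI) simp
  then show False using q(2) by blast
qed

end

theorem theorem4p1:
  fixes smul :: "'f::real_or_complex_field \<Rightarrow> 'h::{real_inner,complete_space} \<Rightarrow> 'h"
    and ip :: "'h \<Rightarrow> 'h \<Rightarrow> 'f"
    and smul' :: "'f \<Rightarrow> 'k::{real_inner,complete_space} \<Rightarrow> 'k"
    and ip' :: "'k \<Rightarrow> 'k \<Rightarrow> 'f"
    and A :: "('h \<Rightarrow>\<^sub>L 'h) set" and B :: "('k \<Rightarrow>\<^sub>L 'k) set"
    and \<pi> :: "('h \<Rightarrow>\<^sub>L 'h) \<Rightarrow> ('k \<Rightarrow>\<^sub>L 'k)"
    and P :: "nat \<Rightarrow> ('h \<Rightarrow>\<^sub>L 'h)" and n :: nat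
    and T Pmeet :: "'h \<Rightarrow>\<^sub>L 'h" and p :: "'k \<Rightarrow>\<^sub>L 'k"
  assumes "hilbert_space_over smul ip" and "hilbert_space_over smul' ip'"
    and "cstar_algebra_on smul ip A" and "cstar_algebra_on smul' ip' B"
    and "cstar_hom smul ip A smul' ip' B \<pi>"
    and "\<And>k. k \<le> n \<Longrightarrow> P k \<in> projections ip A"
    and T_eq: "T = op_prod P n"
    and Pmeet_eq: "Pmeet = proj_meet smul ip (P ` {..n})"
    and p_eq: "p = proj_meet smul' ip' ((\<lambda>k. \<pi> (P k)) ` {..n})"
  shows "(spectral_gap_at_one smul (adj ip T o\<^sub>L T) \<longrightarrow> Pmeet \<in> A \<and> \<pi> Pmeet = p) \<and>
    (real_rank_zero smul ip A \<and>
     sigma_closed proj_le 0 (projections ip' B) \<and>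
     {a \<in> A. \<pi> a = 0} \<subseteq> compact_ops smul \<and>
     (\<exists>R \<in> projections ip A. (\<forall>k\<le>n. proj_le R (P k)) \<and>
        is_glb proj_le (projections ip' B) ((\<lambda>k. \<pi> (P k)) ` {..n}) (\<pi> R))
     \<longrightarrow> spectral_gap_at_one smul (adj ip T o\<^sub>L T))"
proof -
  interpret H: hilbert_space_over smul ip by fact
  interpret K: hilbert_space_over smul' ip' by fact
  interpret hom: real_op_hom A \<pi> by (rule real_op_hom_of_cstar_hom) fact+
  have AB: "A \<subseteq> bounded_ops smul" and adj_A: "\<And>a. a \<in> A \<Longrightarrow> adj ip a \<in> A"
    and BB: "B \<subseteq> bounded_ops smul'"
    using assms(3,4) by (auto simp: cstar_algebra_on_def)
  have \<pi>B: "\<pi> ` A \<subseteq> B" and hom_adj: "\<And>a. a \<in> A \<Longrightarrow> \<pi> (adj ip a) = adj ip' (\<pi> a)"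
    using assms(5) by (auto simp: cstar_hom_def)
  have P: "P k \<in> A" "is_projection (P k)" if "k \<le> n" for k
    using assms(6)[OF that] H.mem_projections_iff[OF AB] by auto
  have \<pi>P: "is_projection (\<pi> (P k))" "\<pi> (P k) \<in> bounded_ops smul'" if "k \<le> n" for k
    using P[OF that] hom.hom_symmetric hom.hom_compose[of "P k" "P k"] \<pi>B BB
    by (auto simp: is_projection_def)
  interpret hom_of_projection_product smul ip smul' ip' A P n \<pi>
    by unfold_locales (use P \<pi>P AB BB \<pi>B adj_A hom_adj in auto)
  show ?thesis
    using meet_preserved gap_of_meet_preserved[OF assms(3,4) \<pi>B]
    unfolding T_eq Pmeet_eq p_eq by blast
qed

end
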